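(* Let $k$ be a covariance kernel on $[0,\infty)^2$, non-negative and bounded, such that $$k(s,t)=k_1(s-t)+h(s,t),\qquad s\ge t\ge 0,$$ where $k_1\ge 0$ and $h\ge 0$. Assume there exist a constant $C>0$ and, for all $M,T>0$, numbers $\delta(M,T)$ with $\delta(M,T)\to 0$ as $T\to\infty$ for every fixed $M$, such that for all $M,T>0$ $$\sup_{t\ge T}\ \sup_{|s-t|\le M}|h(s,t)-C|\le\delta(M,T),\qquad \sup_{s\ge t\ge T}|h(s,t)|\le C .$$ Then, regardless of the way $t$ goes to infinity (i.e. as $t\to\infty$ and $s-t\to\infty$, with no constraint on their relative rates, and in particular for the iterated limit below), $$\lim_{t\to\infty}\lim_{s-t\to\infty}\frac1{s-t}\log H_k(s,t)=\lim_{t\to\infty}\lim_{s-t\to\infty}\frac1{s-t}\log H_{C+k_1}(s,t)=\lambda_c(H_{C+k_1}).$$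
   Context: For a bounded measurable kernel $k\ge0$, $H_k(s,t)$, $s\ge t\ge 0$, is the solution (of at most exponential growth in $s-t$) of the Kraichnan equation $$\partial_sH(s,t)=\int_t^sH(s,u)H(u,t)k(s,u)\,du,\quad s\ge t,\qquad H(t,t)=1 .$$ It is given explicitly by $$H_k(s,t)=\sum_{n\ge0}\int_{t\le t_1\le\cdots\le t_{2n}\le s}\ \sum_{\sigma\in \mathrm{NCP}_n}\ \prod_{i:\,i<\sigma(i)}k(t_i,t_{\sigma(i)})\,dt_1\cdots dt_{2n}$$ (the $n=0$ term is $1$), where $\mathrm{NCP}_n$ is the set of fixed-point-free involutions $\sigma$ of $\{1,\dots,2n\}$ without crossings (no $i<j<\sigma(i)<\sigma(j)$), and $k$ is symmetric in its two arguments. Covariance kernel: symmetric and positive semidefinite. $h$ is defined for $s\ge t$ and extended symmetrically. $C+k_1$ denotes the stationary kernel $(s,t)\mapsto C+k_1(|s-t|)$. For it $H_{C+k_1}(s,t)$ depends only on $s-t$, and is also written $H_{C+k_1}(s-t)$. For such a one-variable $H$, $\lambda_c(H)=\inf\{\lambda\in\mathbb R:\int_0^\infty e^{-\lambda u}H(u)\,du<\infty\}$. *)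

theory Defs
  imports "HOL-Analysis.Analysis"
begin

text \<open>Kernels on \<open>[0,\<infinity>)\<^sup>2\<close> are total functions of two reals whose values outside the quadrant
  are irrelevant.\<close>

definition covariance_kernel :: "(real \<Rightarrow> real \<Rightarrow> real) \<Rightarrow> bool" where
  "covariance_kernel k \<longleftrightarrow>
     (\<forall>s\<ge>0. \<forall>t\<ge>0. k s t = k t s) \<and>
     (\<forall>(n::nat) (x :: nat \<Rightarrow> real) (c :: nat \<Rightarrow> real).
        (\<forall>i<n. 0 \<le> x i) \<longrightarrow> 0 \<le> (\<Sum>i<n. \<Sum>j<n. c i * c j * k (x i) (x j)))"

text \<open>The Kraichnan equation
  \<open>\<partial>\<^sub>s H(s,t) = \<integral>\<^sub>t\<^sup>s H(s,u) H(u,t) k(s,u) du\<close>, \<open>H(t,t) = 1\<close>.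
  For a kernel that is only measurable, the right-hand side is only measurable in \<open>s\<close>, so the
  equation is meant in the sense of Caratheodory: it is integrated in \<open>s\<close> from \<open>t\<close>, which also
  incorporates the initial condition. A solution lives on \<open>s \<ge> t \<ge> 0\<close>; it is set to 0 elsewhere
  so that it is determined as a total function.\<close>

definition kraichnan_solution :: "(real \<Rightarrow> real \<Rightarrow> real) \<Rightarrow> (real \<Rightarrow> real \<Rightarrow> real) \<Rightarrow> bool" where
  "kraichnan_solution k H \<longleftrightarrow>
     (\<lambda>(s, t). H s t) \<in> borel_measurable borel \<and>
     (\<exists>A c. \<forall>s t. 0 \<le> t \<and> t \<le> s \<longrightarrow> \<bar>H s t\<bar> \<le> A * exp (c * (s - t))) \<and>
     (\<forall>s t. 0 \<le> t \<and> t \<le> s \<longrightarrow>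
        H s t = 1 + (LINT r:{t..s}|lborel. LINT u:{t..r}|lborel. H r u * H u t * k r u)) \<and>
     (\<forall>s t. \<not> (0 \<le> t \<and> t \<le> s) \<longrightarrow> H s t = 0)"

definition kraichnan_H :: "(real \<Rightarrow> real \<Rightarrow> real) \<Rightarrow> real \<Rightarrow> real \<Rightarrow> real" where
  "kraichnan_H k = (THE H. kraichnan_solution k H)"

definition stationary_kernel :: "real \<Rightarrow> (real \<Rightarrow> real) \<Rightarrow> real \<Rightarrow> real \<Rightarrow> real" where
  "stationary_kernel C k1 s t = C + k1 \<bar>s - t\<bar>"

text \<open>The infimum is taken in the extended reals, so that it is meaningful also for an empty or
  unbounded set. The function \<open>H\<close> is meant to be non-negative.\<close>

definition lambda_c :: "(real \<Rightarrow> real) \<Rightarrow> ereal" where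
  "lambda_c H =
     Inf (ereal ` {l. (\<integral>\<^sup>+u\<in>{0..}. ennreal (exp (- l * u) * H u) \<partial>lborel) < \<infinity>})"

text \<open>\<open>1/(s-t) log H(s,t)\<close> tends to \<open>L\<close> however \<open>t \<rightarrow> \<infinity>\<close> and \<open>s - t \<rightarrow> \<infinity>\<close>: jointly
  (the product filter imposes no relation between the rates), and as the iterated limit, whose
  inner limit exists for all large \<open>t\<close>. Here \<open>u\<close> stands for \<open>s - t\<close>.\<close>

definition has_growth_rate :: "(real \<Rightarrow> real \<Rightarrow> real) \<Rightarrow> real \<Rightarrow> bool" where
  "has_growth_rate H L \<longleftrightarrow>
     ((\<lambda>(t, u). ln (H (t + u) t) / u) \<longlongrightarrow> L) (at_top \<times>\<^sub>F at_top) \<and>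
     (\<exists>l. (\<forall>\<^sub>F t in at_top. ((\<lambda>u. ln (H (t + u) t) / u) \<longlongrightarrow> l t) at_top) \<and>
          (l \<longlongrightarrow> L) at_top)"

end

theory Submission
  imports Defs
begin

text \<open>The iterates of the integrated Kraichnan equation increase with the number of steps and with the
  kernel, and their supremum \<open>H\<close> is the unique solution. It is supermultiplicative,
  \<open>H(s,v) H(v,t) \<le> H(s,t)\<close>: both sides, as functions of \<open>s \<ge> v\<close>, satisfy the same linear Volterra
  equation, except that the right-hand side has an additional non-negative source. For
  \<open>\<kappa> = C + k\<^sub>1\<close>, Fekete's lemma therefore gives the rate \<open>L = sup (ln H\<^sub>\<kappa>(u) / u)\<close>, which is then also
  the abscissa \<open>\<lambda>\<^sub>c\<close>. Since \<open>k \<le> \<kappa>\<close> away from \<open>t = 0\<close>, the rate of \<open>H\<^sub>k\<close> is at most \<open>L\<close>. Conversely, cut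
  \<open>[t,s]\<close> into blocks of a fixed length \<open>M\<close>: for large \<open>t\<close> the kernel is at least \<open>\<theta> \<kappa>\<close> on every block,
  with \<open>\<theta> < 1\<close> as close to \<open>1\<close> as desired, so the supermultiplicativity of \<open>H\<^sub>k\<close> gives the rate at least
  \<open>ln H\<^sub>\<kappa>(M) / M\<close>, up to an error that is arbitrarily small.\<close>

section \<open>Picard iteration of the Kraichnan equation\<close>

text \<open>Values in \<open>ennreal\<close> give every integral a meaning without integrability
  conditions. The start at 0 makes the iterates increase, and iterate \<open>n\<close> is a
  polynomial in the kernel of degree at most \<open>2 ^ n - 1\<close>.\<close>

primrec kraichnan_iter :: "(real \<Rightarrow> real \<Rightarrow> ennreal) \<Rightarrow> nat \<Rightarrow> real \<Rightarrow> real \<Rightarrow> ennreal" where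
  "kraichnan_iter K 0 = (\<lambda>s t. 0)"
| "kraichnan_iter K (Suc n) = (\<lambda>s t. 1 + (\<integral>\<^sup>+r\<in>{t..s}. (\<integral>\<^sup>+u\<in>{t..r}.
      kraichnan_iter K n r u * kraichnan_iter K n u t * K r u \<partial>lborel) \<partial>lborel))"

definition kraichnan_sup :: "(real \<Rightarrow> real \<Rightarrow> ennreal) \<Rightarrow> real \<Rightarrow> real \<Rightarrow> ennreal" where
  "kraichnan_sup K s t = (SUP n. kraichnan_iter K n s t)"

lemma nn_set_integral_cmult:
  fixes c :: ennreal
  assumes [measurable]: "f \<in> borel_measurable M" "A \<in> sets M"
  shows "(\<integral>\<^sup>+x\<in>A. c * f x \<partial>M) = c * (\<integral>\<^sup>+x\<in>A. f x \<partial>M)"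
  by (subst nn_integral_cmult[symmetric]) (auto simp: ac_simps)

lemma SUP_mult_incseq_ennreal:
  fixes f g :: "nat \<Rightarrow> ennreal"
  assumes "incseq f" "incseq g"
  shows "(SUP n. f n * g n) = (SUP n. f n) * (SUP n. g n)"
proof (rule antisym)
  show "(SUP n. f n * g n) \<le> (SUP n. f n) * (SUP n. g n)"
    by (intro SUP_least mult_mono SUP_upper) auto
  have "f i * g j \<le> (SUP n. f n * g n)" for i j
  proof -
    have "f i * g j \<le> f (max i j) * g (max i j)"
      using assms by (intro mult_mono) (auto simp: incseq_def)
    then show ?thesis by (rule order_trans) (rule SUP_upper, simp)
  qed
  then show "(SUP n. f n) * (SUP n. g n) \<le> (SUP n. f n * g n)"
    unfolding SUP_mult_left_ennreal SUP_mult_right_ennreal by (intro SUP_least)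
qed

lemma volterra_measurable:
  fixes F G K :: "real \<Rightarrow> real \<Rightarrow> ennreal"
  assumes [measurable]: "case_prod F \<in> borel_measurable (borel \<Otimes>\<^sub>M borel)"
    "case_prod G \<in> borel_measurable (borel \<Otimes>\<^sub>M borel)" "case_prod K \<in> borel_measurable (borel \<Otimes>\<^sub>M borel)"
  shows "(\<lambda>(s, t). \<integral>\<^sup>+r\<in>{t..s}. (\<integral>\<^sup>+u\<in>{t..r}. F r u * G u t * K r u \<partial>lborel) \<partial>lborel)
    \<in> borel_measurable (borel \<Otimes>\<^sub>M borel)"
  \<comment> \<open>With the indicators unfolded, the moving intervals become inequalities between
    the variables, so the integrand is jointly measurable in all of them.\<close>
  unfolding indicator_def atLeastAtMost_iff of_bool_def by measurable

lemma inner_measurable: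
  fixes F G K :: "real \<Rightarrow> real \<Rightarrow> ennreal"
  assumes [measurable]: "case_prod F \<in> borel_measurable (borel \<Otimes>\<^sub>M borel)"
    "case_prod G \<in> borel_measurable (borel \<Otimes>\<^sub>M borel)" "case_prod K \<in> borel_measurable (borel \<Otimes>\<^sub>M borel)"
  shows "(\<lambda>r. \<integral>\<^sup>+u\<in>{t..r}. F r u * G u t * K r u \<partial>lborel) \<in> borel_measurable borel"
  unfolding indicator_def atLeastAtMost_iff of_bool_def by measurable

lemma kraichnan_iter_measurable:
  assumes [measurable]: "case_prod K \<in> borel_measurable (borel \<Otimes>\<^sub>M borel)"
  shows "case_prod (kraichnan_iter K n) \<in> borel_measurable (borel \<Otimes>\<^sub>M borel)"
proof (induction n)
  case (Suc n)
  note volterra_measurable[OF Suc Suc assms, measurable]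
  have "case_prod (kraichnan_iter K (Suc n)) = (\<lambda>x. 1 + (case x of (s, t) \<Rightarrow> \<integral>\<^sup>+r\<in>{t..s}. (\<integral>\<^sup>+u\<in>{t..r}.
      kraichnan_iter K n r u * kraichnan_iter K n u t * K r u \<partial>lborel) \<partial>lborel))"
    by auto
  then show ?case by simp
qed simp

lemma kraichnan_sup_measurable:
  assumes "case_prod K \<in> borel_measurable (borel \<Otimes>\<^sub>M borel)"
  shows "case_prod (kraichnan_sup K) \<in> borel_measurable (borel \<Otimes>\<^sub>M borel)"
proof -
  note kraichnan_iter_measurable[OF assms, measurable]
  show ?thesis unfolding kraichnan_sup_def by measurable
qed

lemma kraichnan_iter_mono_kernel:
  assumes "\<And>u r. t \<le> u \<Longrightarrow> u \<le> r \<Longrightarrow> r \<le> s \<Longrightarrow> K r u \<le> K' r u"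
  shows "kraichnan_iter K n s t \<le> kraichnan_iter K' n s t"
  using assms
proof (induction n arbitrary: s t)
  case (Suc n)
  have "kraichnan_iter K n r u * kraichnan_iter K n u t * K r u
      \<le> kraichnan_iter K' n r u * kraichnan_iter K' n u t * K' r u"
    if "t \<le> u" "u \<le> r" "r \<le> s" for r u
    using that by (intro mult_mono Suc) auto
  then show ?case
    by (auto intro!: nn_integral_mono split: split_indicator)
qed simp

lemma incseq_kraichnan_iter: "incseq (\<lambda>n. kraichnan_iter K n s t)"
proof (rule incseq_SucI)
  fix n show "kraichnan_iter K n s t \<le> kraichnan_iter K (Suc n) s t"
  proof (induction n arbitrary: s t)
    case (Suc n)
    have "kraichnan_iter K (Suc n) s t = 1 + (\<integral>\<^sup>+r\<in>{t..s}. (\<integral>\<^sup>+u\<in>{t..r}.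
      kraichnan_iter K n r u * kraichnan_iter K n u t * K r u \<partial>lborel) \<partial>lborel)" by simp
    also have "\<dots> \<le> 1 + (\<integral>\<^sup>+r\<in>{t..s}. (\<integral>\<^sup>+u\<in>{t..r}.
      kraichnan_iter K (Suc n) r u * kraichnan_iter K (Suc n) u t * K r u \<partial>lborel) \<partial>lborel)"
      by (intro add_left_mono nn_integral_mono mult_mono Suc.IH) auto
    also have "\<dots> = kraichnan_iter K (Suc (Suc n)) s t" by (subst (3) kraichnan_iter.simps(2)) simp
    finally show ?case .
  qed simp
qed

lemma kraichnan_iter_le_sup: "kraichnan_iter K n s t \<le> kraichnan_sup K s t"
  unfolding kraichnan_sup_def by (rule SUP_upper) simp

text \<open>Monotone convergence, first in the inner and then in the outer integral, carries the
  supremum through the recursion. The identity lives in \<open>ennreal\<close> and covers infinite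
  values.\<close>

lemma kraichnan_sup_eq:
  assumes meas[measurable]: "case_prod K \<in> borel_measurable (borel \<Otimes>\<^sub>M borel)"
  shows "kraichnan_sup K s t = 1 + (\<integral>\<^sup>+r\<in>{t..s}. (\<integral>\<^sup>+u\<in>{t..r}.
      kraichnan_sup K r u * kraichnan_sup K u t * K r u \<partial>lborel) \<partial>lborel)"
proof -
  note kraichnan_iter_measurable[OF meas, measurable]
  note inner_measurable[OF kraichnan_iter_measurable[OF meas] kraichnan_iter_measurable[OF meas] meas, measurable]
  let ?I = "\<lambda>n r u. kraichnan_iter K n r u * kraichnan_iter K n u t * K r u"
  have inc: "incseq (\<lambda>n. ?I n r u * indicator {t..r} u)" for r u
    using incseq_kraichnan_iter[of K r u] incseq_kraichnan_iter[of K u t]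
    by (auto simp: incseq_def intro!: mult_right_mono mult_mono)
  have sup: "(SUP n. ?I n r u * indicator {t..r} u)
      = kraichnan_sup K r u * kraichnan_sup K u t * K r u * indicator {t..r} u" for r u
    by (simp add: kraichnan_sup_def SUP_mult_right_ennreal[symmetric]
        SUP_mult_incseq_ennreal[OF incseq_kraichnan_iter incseq_kraichnan_iter])
  have "(\<integral>\<^sup>+u\<in>{t..r}. kraichnan_sup K r u * kraichnan_sup K u t * K r u \<partial>lborel)
      = (SUP n. \<integral>\<^sup>+u\<in>{t..r}. ?I n r u \<partial>lborel)" for r
    unfolding sup[symmetric]
    by (rule nn_integral_monotone_convergence_SUP) (use inc in \<open>auto simp: incseq_def le_fun_def\<close>)
  then have "(\<integral>\<^sup>+r\<in>{t..s}. (\<integral>\<^sup>+u\<in>{t..r}.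
      kraichnan_sup K r u * kraichnan_sup K u t * K r u \<partial>lborel) \<partial>lborel)
    = (\<integral>\<^sup>+r. (SUP n. (\<integral>\<^sup>+u\<in>{t..r}. ?I n r u \<partial>lborel) * indicator {t..s} r) \<partial>lborel)"
    by (simp add: SUP_mult_right_ennreal)
  also have "\<dots> = (SUP n. \<integral>\<^sup>+r\<in>{t..s}. (\<integral>\<^sup>+u\<in>{t..r}. ?I n r u \<partial>lborel) \<partial>lborel)"
  proof (rule nn_integral_monotone_convergence_SUP)
    have "(\<integral>\<^sup>+u\<in>{t..r}. ?I m r u \<partial>lborel) \<le> (\<integral>\<^sup>+u\<in>{t..r}. ?I n r u \<partial>lborel)" if "m \<le> n" for m n r
      using that by (intro nn_integral_mono incseqD[OF inc])
    then show "incseq (\<lambda>n r. (\<integral>\<^sup>+u\<in>{t..r}. ?I n r u \<partial>lborel) * indicator {t..s} r)"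
      by (auto simp: incseq_def le_fun_def intro!: mult_right_mono)
  qed measurable
  finally have "1 + (\<integral>\<^sup>+r\<in>{t..s}. (\<integral>\<^sup>+u\<in>{t..r}.
      kraichnan_sup K r u * kraichnan_sup K u t * K r u \<partial>lborel) \<partial>lborel)
    = (SUP n. kraichnan_iter K (Suc n) s t)"
    by (simp add: ennreal_SUP_add_right)
  also have "\<dots> = kraichnan_sup K s t"
    unfolding kraichnan_sup_def
  proof (rule antisym)
    show "(SUP n. kraichnan_iter K (Suc n) s t) \<le> (SUP n. kraichnan_iter K n s t)"
      by (intro SUP_least SUP_upper) simp
    show "(SUP n. kraichnan_iter K n s t) \<le> (SUP n. kraichnan_iter K (Suc n) s t)"
      using incseq_kraichnan_iter[of K s t] unfolding incseq_Suc_iff by (intro SUP_mono) blast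
  qed
  finally show ?thesis by simp
qed

section \<open>Supermultiplicativity\<close>

text \<open>Only the first factor is an iterate, which permits induction on \<open>n\<close>: the
  recursion started at \<open>v\<close>, multiplied by the constant \<open>?c\<close>, has an
  integrand that the induction hypothesis puts below that of the equation started at
  \<open>t\<close>.\<close>

lemma kraichnan_iter_supermult:
  assumes meas[measurable]: "case_prod K \<in> borel_measurable (borel \<Otimes>\<^sub>M borel)"
    and "t \<le> v" "v \<le> s"
  shows "kraichnan_iter K n s v * kraichnan_sup K v t \<le> kraichnan_sup K s t"
  using assms(2,3)
proof (induction n arbitrary: s)
  case (Suc n)
  let ?J = "\<lambda>r. \<integral>\<^sup>+u\<in>{t..r}. kraichnan_sup K r u * kraichnan_sup K u t * K r u \<partial>lborel"
  let ?c = "kraichnan_sup K v t"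
  let ?N = "\<lambda>r. \<integral>\<^sup>+u\<in>{v..r}. kraichnan_iter K n r u * kraichnan_iter K n u v * K r u \<partial>lborel"
  note [measurable] = inner_measurable[OF kraichnan_sup_measurable[OF meas] kraichnan_sup_measurable[OF meas] meas]
     inner_measurable[OF kraichnan_iter_measurable[OF meas] kraichnan_iter_measurable[OF meas] meas]
     kraichnan_iter_measurable[OF meas]
  have *: "?N r * ?c \<le> ?J r" if "v \<le> r" "r \<le> s" for r
  proof -
    have "?N r * ?c = (\<integral>\<^sup>+u\<in>{v..r}. kraichnan_iter K n r u * (kraichnan_iter K n u v * ?c) * K r u \<partial>lborel)"
      by (subst (3) mult.commute, subst nn_set_integral_cmult[symmetric]) (auto simp: ac_simps)
    \<comment> \<open>The induction hypothesis absorbs \<open>?c\<close>, replacing the base point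
      \<open>v\<close> by \<open>t\<close>; enlarging \<open>{v..r}\<close> to \<open>{t..r}\<close>
      adds a non-negative part.\<close>
    also have "\<dots> \<le> ?J r"
      using Suc that
      by (intro nn_integral_mono) (auto split: split_indicator intro!: mult_mono kraichnan_iter_le_sup)
    finally show ?thesis .
  qed
  have "kraichnan_iter K (Suc n) s v * ?c = ?c + (\<integral>\<^sup>+r\<in>{v..s}. ?N r * ?c \<partial>lborel)"
    by (simp add: distrib_left nn_set_integral_cmult mult.commute[of _ ?c])
  \<comment> \<open>Dropping the null set \<open>{v}\<close> makes the range disjoint from
    \<open>{t..v}\<close>, over which \<open>?c\<close> itself is expanded next.\<close>
  also have "\<dots> \<le> ?c + (\<integral>\<^sup>+r\<in>{v<..s}. ?J r \<partial>lborel)"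
  proof (intro add_left_mono nn_integral_mono_AE)
    show "AE r in lborel. ?N r * ?c * indicator {v..s} r \<le> ?J r * indicator {v<..s} r"
      using AE_lborel_singleton[of v] by eventually_elim (use * in \<open>auto split: split_indicator\<close>)
  qed
  also have "\<dots> = 1 + ((\<integral>\<^sup>+r\<in>{t..v}. ?J r \<partial>lborel) + (\<integral>\<^sup>+r\<in>{v<..s}. ?J r \<partial>lborel))"
    by (subst kraichnan_sup_eq[OF meas]) (simp add: add.assoc)
  also have "(\<integral>\<^sup>+r\<in>{t..v}. ?J r \<partial>lborel) + (\<integral>\<^sup>+r\<in>{v<..s}. ?J r \<partial>lborel) = (\<integral>\<^sup>+r\<in>{t..s}. ?J r \<partial>lborel)"
    using Suc.prems
    by (subst nn_integral_add[symmetric]) (auto intro!: nn_integral_cong split: split_indicator)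
  also have "1 + \<dots> = kraichnan_sup K s t"
    by (rule kraichnan_sup_eq[OF meas, symmetric])
  finally show ?case .
qed simp

lemma kraichnan_sup_supermult:
  assumes "case_prod K \<in> borel_measurable (borel \<Otimes>\<^sub>M borel)" "t \<le> v" "v \<le> s"
  shows "kraichnan_sup K s v * kraichnan_sup K v t \<le> kraichnan_sup K s t"
  unfolding kraichnan_sup_def[of K s v] SUP_mult_right_ennreal
  using kraichnan_iter_supermult[OF assms] by (intro SUP_least) simp

section \<open>Scaling and translating the kernel\<close>

text \<open>Each step multiplies two iterates and one kernel value, so the exponent doubles and
  grows by one. The constant term 1 is not harmed because \<theta> \<le> 1.\<close>

lemma kraichnan_iter_scale:
  assumes meas[measurable]: "case_prod K \<in> borel_measurable (borel \<Otimes>\<^sub>M borel)"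
    and "\<theta> \<le> 1"
  shows "\<theta> ^ (2 ^ n - 1) * kraichnan_iter K n s t \<le> kraichnan_iter (\<lambda>s t. \<theta> * K s t) n s t"
proof (induction n arbitrary: s t)
  case (Suc n)
  let ?a = "2 ^ n - 1 :: nat"
  note [measurable] = inner_measurable[OF kraichnan_iter_measurable[OF meas] kraichnan_iter_measurable[OF meas] meas]
     kraichnan_iter_measurable[OF meas]
  let ?P = "kraichnan_iter K n" and ?Q = "kraichnan_iter (\<lambda>s t. \<theta> * K s t) n"
  have a: "2 ^ Suc n - 1 = ?a + ?a + 1" by (induction n) auto
  have "\<theta> ^ (2 ^ Suc n - 1) * kraichnan_iter K (Suc n) s t
    = \<theta> ^ (2 ^ Suc n - 1) + (\<integral>\<^sup>+r\<in>{t..s}. (\<integral>\<^sup>+u\<in>{t..r}.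
      (\<theta> ^ ?a * ?P r u) * (\<theta> ^ ?a * ?P u t) * (\<theta> * K r u) \<partial>lborel) \<partial>lborel)"
  proof -
    have "(\<integral>\<^sup>+u\<in>{t..r}. (\<theta> ^ ?a * ?P r u) * (\<theta> ^ ?a * ?P u t) * (\<theta> * K r u) \<partial>lborel)
      = \<theta> ^ (2 ^ Suc n - 1) * (\<integral>\<^sup>+u\<in>{t..r}. ?P r u * ?P u t * K r u \<partial>lborel)" for r
      unfolding a power_add by (subst nn_set_integral_cmult[symmetric]) (auto simp: ac_simps)
    then show ?thesis
      by (simp add: distrib_left nn_set_integral_cmult del: power_Suc)
  qed
  also have "\<dots> \<le> 1 + (\<integral>\<^sup>+r\<in>{t..s}. (\<integral>\<^sup>+u\<in>{t..r}. ?Q r u * ?Q u t * (\<theta> * K r u) \<partial>lborel) \<partial>lborel)"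
    using assms(2) by (intro add_mono nn_integral_mono mult_mono Suc power_le_one) auto
  finally show ?case by simp
qed simp

lemma nn_integral_shift:
  fixes f :: "real \<Rightarrow> ennreal"
  assumes "f \<in> borel_measurable borel"
  shows "(\<integral>\<^sup>+x. f x \<partial>lborel) = (\<integral>\<^sup>+x. f (x + a) \<partial>lborel)"
  using nn_integral_real_affine[OF assms, of 1 a] by (simp add: add.commute)

lemma kraichnan_iter_translate:
  assumes meas[measurable]: "case_prod K \<in> borel_measurable (borel \<Otimes>\<^sub>M borel)"
    and stat: "\<And>s t. K (s + a) (t + a) = K s t"
  shows "kraichnan_iter K n (s + a) (t + a) = kraichnan_iter K n s t"
proof (induction n arbitrary: s t)
  case (Suc n)
  note [measurable] = inner_measurable[OF kraichnan_iter_measurable[OF meas] kraichnan_iter_measurable[OF meas] meas]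
     kraichnan_iter_measurable[OF meas]
  have "kraichnan_iter K (Suc n) (s + a) (t + a) = 1 + (\<integral>\<^sup>+r\<in>{t + a..s + a}. (\<integral>\<^sup>+u\<in>{t + a..r}.
      kraichnan_iter K n r u * kraichnan_iter K n u (t + a) * K r u \<partial>lborel) \<partial>lborel)" by simp
  also have "\<dots> = 1 + (\<integral>\<^sup>+r. (\<integral>\<^sup>+u\<in>{t + a..r + a}. kraichnan_iter K n (r + a) u *
      kraichnan_iter K n u (t + a) * K (r + a) u \<partial>lborel) * indicator {t + a..s + a} (r + a) \<partial>lborel)"
    by (subst nn_integral_shift[of _ a]) auto
  also have "\<dots> = 1 + (\<integral>\<^sup>+r. (\<integral>\<^sup>+u. kraichnan_iter K n (r + a) (u + a) *
      kraichnan_iter K n (u + a) (t + a) * K (r + a) (u + a) * indicator {t + a..r + a} (u + a) \<partial>lborel)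
      * indicator {t + a..s + a} (r + a) \<partial>lborel)"
    by (subst nn_integral_shift[of "\<lambda>u. _ u * indicator _ u" a]) auto
  also have "\<dots> = kraichnan_iter K (Suc n) s t"
    by (simp add: Suc stat indicator_def)
  finally show ?case .
qed simp


text \<open>The supersolution is \<open>f(x) = e\<^bsup>lx\<^esup> / (1 + x)\<^sup>2\<close> rather than a pure exponential, because the
  integrable factor \<open>(1 + x)\<^sup>-\<^sup>2\<close> makes \<open>f\<close> stable under convolution: \<open>f * f \<le> 4 f\<close>.\<close>

lemma kraichnan_inner_bound:
  fixes K :: "real \<Rightarrow> real \<Rightarrow> ennreal" and B l :: real
  defines "f \<equiv> (\<lambda>x. exp (l * x) / (1 + x)\<^sup>2)"
  assumes "0 \<le> B" and K: "\<And>r u. K r u \<le> ennreal B"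
    and F: "\<And>r u. u \<le> r \<Longrightarrow> F r u \<le> ennreal (f (r - u))" and "t \<le> r"
  shows "(\<integral>\<^sup>+u\<in>{t..r}. F r u * F u t * K r u \<partial>lborel) \<le> ennreal (4 * B * f (r - t))"
proof -
  let ?g = "\<lambda>x::real. 1 / (1 + x)\<^sup>2"
  let ?c = "2 * B * f (r - t)"
  have f0: "0 \<le> f x" for x by (simp add: f_def)
  \<comment> \<open>The exponentials multiply exactly. For the weights,
    \<open>(1 + (x + y))\<^sup>2\<close> is at most twice the sum of the squares of
    \<open>1 + x\<close> and \<open>1 + y\<close>; dividing by the product of these squares
    separates the variables.\<close>
  have gg: "f x * f y \<le> 2 * f (x + y) * (?g x + ?g y)" if "0 \<le> x" "0 \<le> y" for x y
  proof -
    have "2 * ((1 + x)\<^sup>2 + (1 + y)\<^sup>2) \<ge> (1 + (x + y))\<^sup>2"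
      using that by (simp add: power2_eq_square algebra_simps) (use sum_squares_ge_zero[of "x - y" 0] that in \<open>auto simp: algebra_simps\<close>)
    then have "1 / ((1 + x)\<^sup>2 * (1 + y)\<^sup>2)
        \<le> (2 * ((1 + x)\<^sup>2 + (1 + y)\<^sup>2) / (1 + (x + y))\<^sup>2) / ((1 + x)\<^sup>2 * (1 + y)\<^sup>2)"
      using that by (intro divide_right_mono) (auto simp: le_divide_eq)
    also have "\<dots> = 2 / (1 + (x + y))\<^sup>2 * (?g x + ?g y)"
      using that by (simp add: field_simps)
    finally have "exp (l * (x + y)) * (1 / ((1 + x)\<^sup>2 * (1 + y)\<^sup>2))
        \<le> exp (l * (x + y)) * (2 / (1 + (x + y))\<^sup>2 * (?g x + ?g y))"
      by (intro mult_left_mono) auto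
    then show ?thesis by (simp add: f_def exp_add distrib_left add_divide_distrib mult_ac)
  qed
  have "(\<integral>\<^sup>+u\<in>{t..r}. F r u * F u t * K r u \<partial>lborel)
      \<le> (\<integral>\<^sup>+u. ennreal (?c * (?g (r - u) + ?g (u - t))) * indicator {t..r} u \<partial>lborel)"
  proof (rule nn_integral_mono)
    fix u :: real
    have "F r u * F u t * K r u \<le> ennreal (?c * (?g (r - u) + ?g (u - t)))" if "t \<le> u" "u \<le> r"
    proof -
      have "F r u * F u t * K r u \<le> ennreal (f (r - u)) * ennreal (f (u - t)) * ennreal B"
        using that by (intro mult_mono F K) auto
      also have "\<dots> = ennreal (f (r - u) * f (u - t) * B)"
        using \<open>0 \<le> B\<close> f0 by (simp add: ennreal_mult)
      also have "\<dots> \<le> ennreal (?c * (?g (r - u) + ?g (u - t)))"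
        using mult_right_mono[OF gg[of "r - u" "u - t"] \<open>0 \<le> B\<close>] that
        by (intro ennreal_leI) (simp add: mult_ac)
      finally show ?thesis .
    qed
    then show "F r u * F u t * K r u * indicator {t..r} u
        \<le> ennreal (?c * (?g (r - u) + ?g (u - t))) * indicator {t..r} u"
      by (auto split: split_indicator)
  qed
  \<comment> \<open>Each \<open>?g\<close> integrates to at most 1 whatever the length of the
    interval, so \<open>?c\<close> is at most doubled.\<close>
  also have "\<dots> = ennreal (?c * (1 / (1 + (r - r)) - 1 / (1 + (r - t)))
      + ?c * (1 / (1 + (t - t)) - 1 / (1 + (r - t))))"
  proof (subst nn_integral_FTC_Icc[where F = "\<lambda>u. ?c * (1 / (1 + (r - u)) - 1 / (1 + (u - t)))"])
    show "((\<lambda>u. ?c * (1 / (1 + (r - u)) - 1 / (1 + (u - t)))) has_real_derivative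
        ?c * (?g (r - u) + ?g (u - t))) (at u)" if "u \<in> {t..r}" for u
      using that by (auto intro!: derivative_eq_intros simp: power2_eq_square)
    show "0 \<le> ?c * (?g (r - u) + ?g (u - t))" for u
      using f0 \<open>0 \<le> B\<close> by simp
  qed (use \<open>t \<le> r\<close> in \<open>auto simp: algebra_simps\<close>)
  also have "\<dots> \<le> ennreal (4 * B * f (r - t))"
  proof (rule ennreal_leI)
    have "?c * (1 - 1 / (1 + (r - t))) \<le> ?c * 1"
      using f0 \<open>0 \<le> B\<close> \<open>t \<le> r\<close> by (intro mult_left_mono) auto
    then show "?c * (1 / (1 + (r - r)) - 1 / (1 + (r - t))) + ?c * (1 / (1 + (t - t)) - 1 / (1 + (r - t)))
      \<le> 4 * B * f (r - t)" by simp
  qed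
  finally show ?thesis .
qed

text \<open>With \<open>?f\<close> inserted, the inner integral is at most
  \<open>4 * B * ?f\<close>. Since \<open>?f' \<ge> (l - 2) * ?f\<close> and
  \<open>l - 2 = 4 * B\<close>, the outer integral is at most \<open>?f (s - t) - ?f 0\<close>, and
  \<open>?f 0 = 1\<close> compensates the initial value.\<close>

lemma kraichnan_iter_bound:
  fixes K :: "real \<Rightarrow> real \<Rightarrow> ennreal" and B l :: real
  assumes "0 \<le> B" and K: "\<And>r u. K r u \<le> ennreal B" and l: "l = 4 * B + 2" and "t \<le> s"
  shows "kraichnan_iter K n s t \<le> ennreal (exp (l * (s - t)) / (1 + (s - t))\<^sup>2)"
  using \<open>t \<le> s\<close>
proof (induction n arbitrary: s t)
  case (Suc n)
  let ?f = "\<lambda>x. exp (l * x) / (1 + x)\<^sup>2"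
  let ?f' = "\<lambda>x. l * exp (l * x) / (1 + x)\<^sup>2 - 2 * exp (l * x) / (1 + x) ^ 3"
  have f': "4 * B * ?f x \<le> ?f' x" if "0 \<le> x" for x
  proof -
    have "exp (l * x) / (1 + x) ^ 3 \<le> ?f x"
      using that by (intro divide_left_mono power_increasing) auto
    then show ?thesis by (simp add: l algebra_simps add_divide_distrib)
  qed
  have deriv: "(?f has_real_derivative ?f' x) (at x)" if "0 \<le> x" for x
  proof -
    have quot: "(l * e * y\<^sup>2 - e * (2 * y)) / (y\<^sup>2 * y\<^sup>2) = l * e / y\<^sup>2 - 2 * e / y ^ 3" if "y \<noteq> 0" for e y :: real
      using that by (simp add: divide_simps power2_eq_square power3_eq_cube) (simp add: algebra_simps)
    have "(?f has_real_derivative (l * exp (l * x) * (1 + x)\<^sup>2 - exp (l * x) * (2 * (1 + x)))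
        / ((1 + x)\<^sup>2 * (1 + x)\<^sup>2)) (at x)"
      using that by (auto intro!: derivative_eq_intros simp: ac_simps)
    then show ?thesis using quot[of "1 + x" "exp (l * x)"] that by simp
  qed
  have f'0: "0 \<le> ?f' x" if "0 \<le> x" for x
    using f'[OF that] \<open>0 \<le> B\<close> by (meson order_trans mult_nonneg_nonneg divide_nonneg_nonneg exp_ge_zero zero_le_power2 zero_le_numeral)
  have "(\<integral>\<^sup>+r\<in>{t..s}. (\<integral>\<^sup>+u\<in>{t..r}.
      kraichnan_iter K n r u * kraichnan_iter K n u t * K r u \<partial>lborel) \<partial>lborel)
    \<le> (\<integral>\<^sup>+r. ennreal (?f' (r - t)) * indicator {t..s} r \<partial>lborel)"
  proof (rule nn_integral_mono)
    fix r
    have "(\<integral>\<^sup>+u\<in>{t..r}. kraichnan_iter K n r u * kraichnan_iter K n u t * K r u \<partial>lborel)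
      \<le> ennreal (?f' (r - t))" if "t \<le> r"
      using kraichnan_inner_bound[OF \<open>0 \<le> B\<close> K Suc.IH that] ennreal_leI[OF f'[of "r - t"]] that
      by (meson diff_ge_0_iff_ge order_trans)
    then show "(\<integral>\<^sup>+u\<in>{t..r}. kraichnan_iter K n r u * kraichnan_iter K n u t * K r u \<partial>lborel)
      * indicator {t..s} r \<le> ennreal (?f' (r - t)) * indicator {t..s} r"
      by (auto split: split_indicator)
  qed
  also have "\<dots> = ennreal (?f (s - t) - ?f (t - t))"
  proof (rule nn_integral_FTC_Icc[where f = "\<lambda>r. ?f' (r - t)" and F = "\<lambda>r. ?f (r - t)"])
    show "((\<lambda>r. ?f (r - t)) has_real_derivative ?f' (r - t)) (at r)" if "r \<in> {t..s}" for r
      using DERIV_shift[of ?f "?f' (r - t)" r "- t"] deriv[of "r - t"] that by simp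
  qed (use f'0 Suc.prems in auto)
  finally have "kraichnan_iter K (Suc n) s t \<le> 1 + ennreal (?f (s - t) - 1)"
    by (simp add: add_left_mono)
  \<comment> \<open>\<open>ennreal\<close> truncates negative numbers to 0, so cancelling the 1
    requires \<open>?f (s - t) \<ge> ?f 0 = 1\<close>, the monotonicity of
    \<open>?f\<close>.\<close>
  also have "\<dots> = ennreal (?f (s - t))"
  proof -
    have "?f 0 \<le> ?f (s - t)"
      using Suc.prems f'0 by (intro DERIV_nonneg_imp_nondecreasing[of 0 "s - t" ?f])
        (auto intro!: exI deriv)
    then show ?thesis by (simp flip: ennreal_1 ennreal_plus)
  qed
  finally show ?case .
qed simp

section \<open>Existence and uniqueness of the solution\<close>

lemma kraichnan_sup_bound:
  fixes K :: "real \<Rightarrow> real \<Rightarrow> ennreal" and B :: real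
  assumes "0 \<le> B" "\<And>r u. K r u \<le> ennreal B" "t \<le> s"
  shows "kraichnan_sup K s t \<le> ennreal (exp ((4 * B + 2) * (s - t)) / (1 + (s - t))\<^sup>2)"
  unfolding kraichnan_sup_def by (intro SUP_least kraichnan_iter_bound[OF assms(1,2) refl assms(3)])

lemma kraichnan_sup_exp_bound:
  fixes K :: "real \<Rightarrow> real \<Rightarrow> ennreal" and B :: real
  assumes "0 \<le> B" "\<And>r u. K r u \<le> ennreal B" "t \<le> s"
  shows "kraichnan_sup K s t \<le> ennreal (exp ((4 * B + 2) * (s - t)))"
proof -
  have "1 \<le> (1 + (s - t))\<^sup>2"
    using assms(3) by (intro one_le_power) auto
  then have "exp ((4 * B + 2) * (s - t)) / (1 + (s - t))\<^sup>2 \<le> exp ((4 * B + 2) * (s - t)) / 1"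
    by (intro divide_left_mono) auto
  then have "ennreal (exp ((4 * B + 2) * (s - t)) / (1 + (s - t))\<^sup>2) \<le> ennreal (exp ((4 * B + 2) * (s - t)))"
    by (intro ennreal_leI) simp
  then show ?thesis
    by (rule order_trans[OF kraichnan_sup_bound[OF assms]])
qed

lemma one_le_kraichnan_sup: "1 \<le> kraichnan_sup K s t"
  by (rule order_trans[OF _ kraichnan_iter_le_sup[of K 1]]) simp

text \<open>The value 0 off the domain follows the convention of \<open>kraichnan_solution\<close>.
  For a bounded kernel the supremum is finite on the domain, so \<open>enn2real\<close> loses
  nothing there.\<close>

definition kraichnan_fun :: "(real \<Rightarrow> real \<Rightarrow> real) \<Rightarrow> real \<Rightarrow> real \<Rightarrow> real" where
  "kraichnan_fun k s t =
     (if 0 \<le> t \<and> t \<le> s then enn2real (kraichnan_sup (\<lambda>s t. ennreal (k s t)) s t) else 0)"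

text \<open>The fixed-point identity in \<open>ennreal\<close> becomes one between Lebesgue
  integrals of real functions, since on the domain the supremum and both its integrals are
  finite.\<close>

lemma kraichnan_solution_kraichnan_fun:
  fixes k :: "real \<Rightarrow> real \<Rightarrow> real" and B :: real
  assumes meas: "(\<lambda>(s, t). k s t) \<in> borel_measurable borel"
    and nonneg: "\<And>s t. 0 \<le> k s t" and bd: "\<And>s t. k s t \<le> B"
  shows "kraichnan_solution k (kraichnan_fun k)"
proof -
  define K where "K = (\<lambda>s t. ennreal (k s t))"
  define S where "S = kraichnan_sup K"
  define H where "H = kraichnan_fun k"
  have B: "0 \<le> B" using nonneg[of 0 0] bd[of 0 0] by linarith
  have KB: "K r u \<le> ennreal B" for r u unfolding K_def by (intro ennreal_leI bd)
  have [measurable]: "case_prod k \<in> borel_measurable (borel \<Otimes>\<^sub>M borel)"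
    using meas by (simp add: borel_prod)
  have meas_K[measurable]: "case_prod K \<in> borel_measurable (borel \<Otimes>\<^sub>M borel)"
    unfolding K_def by measurable
  have meas_S[measurable]: "case_prod S \<in> borel_measurable (borel \<Otimes>\<^sub>M borel)"
    unfolding S_def by (rule kraichnan_sup_measurable[OF meas_K])
  have H_eq: "H = (\<lambda>s t. if 0 \<le> t \<and> t \<le> s then enn2real (S s t) else 0)"
    by (simp add: H_def S_def K_def kraichnan_fun_def fun_eq_iff)
  have [measurable]: "case_prod H \<in> borel_measurable (borel \<Otimes>\<^sub>M borel)"
    unfolding H_eq by measurable
  have fin: "S s t < top" if "t \<le> s" for s t
    unfolding S_def by (rule le_less_trans[OF kraichnan_sup_exp_bound[OF B KB that] ennreal_less_top])
  have SH: "S s t = ennreal (H s t)" if "0 \<le> t" "t \<le> s" for s t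
    using fin[OF that(2)] that by (simp add: H_eq)
  have H0: "0 \<le> H s t" for s t by (simp add: H_eq)
  have eq: "H s t = 1 + (LINT r:{t..s}|lborel. LINT u:{t..r}|lborel. H r u * H u t * k r u)"
    if "0 \<le> t" "t \<le> s" for s t
  proof -
    define N where "N = (\<lambda>r. \<integral>\<^sup>+u\<in>{t..r}. S r u * S u t * K r u \<partial>lborel)"
    have [measurable]: "N \<in> borel_measurable borel"
      unfolding N_def by (rule inner_measurable[OF meas_S meas_S meas_K])
    \<comment> \<open>The weighted bound, not the plain exponential one, has the shape that the
      convolution estimate accepts.\<close>
    have N_fin: "N r < top" if "t \<le> r" for r
      unfolding N_def S_def
      by (rule le_less_trans[OF kraichnan_inner_bound[OF B KB kraichnan_sup_bound[OF B KB] that] ennreal_less_top])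
    have inner: "(LINT u:{t..r}|lborel. H r u * H u t * k r u) = enn2real (N r)" for r
    proof -
      have "(LINT u:{t..r}|lborel. H r u * H u t * k r u)
        = enn2real (\<integral>\<^sup>+u. ennreal (indicator {t..r} u *\<^sub>R (H r u * H u t * k r u)) \<partial>lborel)"
        unfolding set_lebesgue_integral_def using H0 nonneg
        by (intro integral_eq_nn_integral) (auto intro!: AE_I2)
      also have "(\<integral>\<^sup>+u. ennreal (indicator {t..r} u *\<^sub>R (H r u * H u t * k r u)) \<partial>lborel) = N r"
        unfolding N_def using \<open>0 \<le> t\<close> H0 nonneg
        by (intro nn_integral_cong) (auto simp: SH K_def ennreal_mult split: split_indicator)
      finally show ?thesis .
    qed
    have "(LINT r:{t..s}|lborel. LINT u:{t..r}|lborel. H r u * H u t * k r u)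
      = enn2real (\<integral>\<^sup>+r. ennreal (indicator {t..s} r *\<^sub>R enn2real (N r)) \<partial>lborel)"
      unfolding set_lebesgue_integral_def inner[unfolded set_lebesgue_integral_def]
      by (intro integral_eq_nn_integral) (auto intro!: AE_I2)
    also have "(\<integral>\<^sup>+r. ennreal (indicator {t..s} r *\<^sub>R enn2real (N r)) \<partial>lborel) = (\<integral>\<^sup>+r\<in>{t..s}. N r \<partial>lborel)"
      using N_fin by (intro nn_integral_cong) (auto split: split_indicator)
    finally have LINT: "(LINT r:{t..s}|lborel. LINT u:{t..r}|lborel. H r u * H u t * k r u)
      = enn2real (\<integral>\<^sup>+r\<in>{t..s}. N r \<partial>lborel)" .
    have "S s t = 1 + (\<integral>\<^sup>+r\<in>{t..s}. N r \<partial>lborel)"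
      unfolding S_def N_def by (rule kraichnan_sup_eq[OF meas_K])
    moreover from this have "(\<integral>\<^sup>+r\<in>{t..s}. N r \<partial>lborel) < top"
      using fin[OF that(2)] by auto
    ultimately show ?thesis
      unfolding LINT using that by (simp add: H_eq enn2real_plus)
  qed
  have "\<bar>H s t\<bar> \<le> 1 * exp ((4 * B + 2) * (s - t))" if "0 \<le> t" "t \<le> s" for s t
    using kraichnan_sup_exp_bound[where K = K, OF B KB that(2)] SH[OF that] H0[of s t] by (simp add: S_def)
  moreover have "(\<lambda>(s, t). H s t) \<in> borel_measurable borel"
    unfolding borel_prod[symmetric] by measurable
  moreover have "H s t = 0" if "\<not> (0 \<le> t \<and> t \<le> s)" for s t using that by (auto simp: H_eq)
  ultimately show ?thesis
    unfolding kraichnan_solution_def H_def[symmetric] using eq by blast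
qed

section \<open>Uniqueness among exponentially bounded solutions\<close>

lemma set_integrable_bounded_Icc:
  fixes f :: "real \<Rightarrow> real"
  assumes "f \<in> borel_measurable borel" "\<And>x. x \<in> {a..b} \<Longrightarrow> \<bar>f x\<bar> \<le> c"
  shows "set_integrable lborel {a..b} f"
  unfolding set_integrable_def using assms
  by (intro integrableI_bounded_set_indicator[where B = c]) (auto simp: emeasure_lborel_Icc_eq)

lemma abs_set_integral_Icc_le:
  fixes f :: "real \<Rightarrow> real"
  assumes "f \<in> borel_measurable borel" "\<And>x. x \<in> {a..b} \<Longrightarrow> \<bar>f x\<bar> \<le> c" "a \<le> b"
  shows "\<bar>LINT x:{a..b}|lborel. f x\<bar> \<le> c * (b - a)"
proof -
  have int: "set_integrable lborel {a..b} f"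
    using assms by (intro set_integrable_bounded_Icc)
  have int_c: "set_integrable lborel {a..b} (\<lambda>_. c)"
    by (intro set_integrable_bounded_Icc[where c = "\<bar>c\<bar>"]) auto
  have "\<bar>LINT x:{a..b}|lborel. f x\<bar> \<le> (LINT x:{a..b}|lborel. \<bar>f x\<bar>)"
    using set_integral_norm_bound[OF int] by simp
  also have "\<dots> \<le> (LINT x:{a..b}|lborel. c)"
    using assms(2) by (intro set_integral_mono set_integrable_abs int int_c)
  also have "\<dots> = c * (b - a)"
    using \<open>a \<le> b\<close> by (simp add: set_lebesgue_integral_def)
  finally show ?thesis .
qed

text \<open>On the triangle \<open>0 \<le> t \<le> s \<le> X\<close> both solutions are bounded, so
  the quadratic right-hand side is Lipschitz there. In the supremum norm with weight
  \<open>exp (- l * (s - t))\<close> the integral operator halves the difference once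
  \<open>l\<close> is large, and iterating forces it to 0.\<close>

lemma kraichnan_solution_unique:
  fixes k :: "real \<Rightarrow> real \<Rightarrow> real" and B :: real
  assumes meas: "(\<lambda>(s, t). k s t) \<in> borel_measurable borel"
    and nonneg: "\<And>s t. 0 \<le> k s t" and bd: "\<And>s t. k s t \<le> B"
    and F: "kraichnan_solution k F" and G: "kraichnan_solution k G"
  shows "F = G"
proof -
  have B: "0 \<le> B" using nonneg[of 0 0] bd[of 0 0] by linarith
  have [measurable]: "case_prod k \<in> borel_measurable (borel \<Otimes>\<^sub>M borel)"
    using meas by (simp add: borel_prod)
  have sol: "case_prod H \<in> borel_measurable (borel \<Otimes>\<^sub>M borel)"
       "\<exists>A. \<forall>s t. 0 \<le> t \<and> t \<le> s \<and> s \<le> X \<longrightarrow> \<bar>H s t\<bar> \<le> A"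
       "\<And>s t. 0 \<le> t \<Longrightarrow> t \<le> s \<Longrightarrow> H s t = 1 + (LINT r:{t..s}|lborel. LINT u:{t..r}|lborel. H r u * H u t * k r u)"
    if H: "kraichnan_solution k H" for H X
  proof -
    obtain A c where Ac: "\<And>s t. 0 \<le> t \<Longrightarrow> t \<le> s \<Longrightarrow> \<bar>H s t\<bar> \<le> A * exp (c * (s - t))"
      using H unfolding kraichnan_solution_def by blast
    have "\<bar>H s t\<bar> \<le> \<bar>A\<bar> * exp (\<bar>c\<bar> * X)" if "0 \<le> t" "t \<le> s" "s \<le> X" for s t
    proof -
      have "A * exp (c * (s - t)) \<le> \<bar>A\<bar> * exp (\<bar>c\<bar> * X)"
        using that by (intro mult_mono) (auto intro!: mult_mono)
      with Ac[OF that(1,2)] show ?thesis by linarith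
    qed
    then show "\<exists>A. \<forall>s t. 0 \<le> t \<and> t \<le> s \<and> s \<le> X \<longrightarrow> \<bar>H s t\<bar> \<le> A" by blast
    show "case_prod H \<in> borel_measurable (borel \<Otimes>\<^sub>M borel)"
      using H unfolding kraichnan_solution_def borel_prod by simp
    show "H s t = 1 + (LINT r:{t..s}|lborel. LINT u:{t..r}|lborel. H r u * H u t * k r u)"
      if "0 \<le> t" "t \<le> s" for s t
      using H that unfolding kraichnan_solution_def by blast
  qed
  note [measurable] = sol(1)[OF F] sol(1)[OF G]
  have "F s t = G s t" if st: "0 \<le> t" "t \<le> s" for s t
  proof -
    \<comment> \<open>\<open>X\<close> freezes the end point, so that \<open>A\<close> and
      \<open>l\<close> stay fixed while the induction varies \<open>s\<close> and \<open>t\<close>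
      below it.\<close>
    define X where "X = s"
    obtain A1 where A1: "\<And>s t. 0 \<le> t \<Longrightarrow> t \<le> s \<Longrightarrow> s \<le> X \<Longrightarrow> \<bar>F s t\<bar> \<le> A1" using sol(2)[OF F, of X] by blast
    obtain A2 where A2: "\<And>s t. 0 \<le> t \<Longrightarrow> t \<le> s \<Longrightarrow> s \<le> X \<Longrightarrow> \<bar>G s t\<bar> \<le> A2" using sol(2)[OF G, of X] by blast
    define A where "A = max A1 A2"
    have FA: "\<bar>F s t\<bar> \<le> A" and GA: "\<bar>G s t\<bar> \<le> A" if "0 \<le> t" "t \<le> s" "s \<le> X" for s t
      using A1[OF that] A2[OF that] by (auto simp: A_def)
    have X0: "0 \<le> X" and A0: "0 \<le> A"
      using st FA[of 0 0] by (auto simp: X_def)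
    \<comment> \<open>Chosen so that the contraction factor \<open>2 * A * B * X / l\<close> is at
      most \<open>1 / 2\<close>; the summand 1 keeps \<open>l\<close> positive.\<close>
    define l where "l = 4 * X * A * B + 1"
    have l: "0 < l" using X0 A0 B by (simp add: l_def add_nonneg_pos)
    have step: "\<bar>F s t - G s t\<bar> \<le> N / 2 * exp (l * (s - t))"
      if N: "\<And>s t. 0 \<le> t \<Longrightarrow> t \<le> s \<Longrightarrow> s \<le> X \<Longrightarrow> \<bar>F s t - G s t\<bar> \<le> N * exp (l * (s - t))"
      and "0 \<le> N" and st: "0 \<le> t" "t \<le> s" "s \<le> X" for N s t
    proof -
      define J where "J = (\<lambda>H r. LINT u:{t..r}|lborel. H r u * H u t * k r u)"
      have J_meas: "J H \<in> borel_measurable borel"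
        if [measurable]: "case_prod H \<in> borel_measurable (borel \<Otimes>\<^sub>M borel)" for H
        unfolding J_def set_lebesgue_integral_def indicator_def atLeastAtMost_iff of_bool_def by measurable
      have FF: "\<bar>F r u * F u t * k r u\<bar> \<le> A * A * B" and GG: "\<bar>G r u * G u t * k r u\<bar> \<le> A * A * B"
        if "r \<in> {t..s}" "u \<in> {t..r}" for r u
        using that st A0 B nonneg[of r u] bd[of r u] unfolding abs_mult
        by (auto intro!: mult_mono FA GA)
      have int_F: "set_integrable lborel {t..r} (\<lambda>u. F r u * F u t * k r u)"
        and int_G: "set_integrable lborel {t..r} (\<lambda>u. G r u * G u t * k r u)" if "r \<in> {t..s}" for r
        using that FF GG by (auto intro!: set_integrable_bounded_Icc[where c = "A * A * B"])
      have J_bd: "\<bar>J F r\<bar> \<le> A * A * B * X" "\<bar>J G r\<bar> \<le> A * A * B * X" if "r \<in> {t..s}" for r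
      proof -
        have "A * A * B * (r - t) \<le> A * A * B * X"
          using that st A0 B by (intro mult_left_mono) auto
        moreover have "\<bar>J F r\<bar> \<le> A * A * B * (r - t)" "\<bar>J G r\<bar> \<le> A * A * B * (r - t)"
          unfolding J_def using that FF GG by (auto intro!: abs_set_integral_Icc_le)
        ultimately show "\<bar>J F r\<bar> \<le> A * A * B * X" "\<bar>J G r\<bar> \<le> A * A * B * X" by linarith+
      qed
      have J_int: "set_integrable lborel {t..s} (J F)" "set_integrable lborel {t..s} (J G)"
        using J_bd J_meas sol(1)[OF F] sol(1)[OF G]
        by (auto intro!: set_integrable_bounded_Icc[where c = "A * A * B * X"])
      let ?c = "2 * A * B * X * N"
      have J_diff: "\<bar>J F r - J G r\<bar> \<le> ?c * exp (l * (r - t))" if r: "r \<in> {t..s}" for r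
      proof -
        have ineq: "\<bar>F r u * F u t * k r u - G r u * G u t * k r u\<bar> \<le> 2 * A * B * N * exp (l * (r - t))"
          if u: "u \<in> {t..r}" for u
        proof -
          have "\<bar>F r u - G r u\<bar> \<le> N * exp (l * (r - u))" "\<bar>F u t - G u t\<bar> \<le> N * exp (l * (u - t))"
            using r u st by (auto intro!: N)
          \<comment> \<open>Both weights are raised to the one for the whole interval; the gain of a
            factor \<open>1 / l\<close> comes only from the outer integral.\<close>
          moreover have "N * exp (l * (r - u)) \<le> N * exp (l * (r - t))" "N * exp (l * (u - t)) \<le> N * exp (l * (r - t))"
            using r u l \<open>0 \<le> N\<close> by (auto intro!: mult_left_mono)
          ultimately have d: "\<bar>F r u - G r u\<bar> \<le> N * exp (l * (r - t))" "\<bar>F u t - G u t\<bar> \<le> N * exp (l * (r - t))"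
            by linarith+
          have "F r u * F u t * k r u - G r u * G u t * k r u
              = ((F r u - G r u) * F u t + G r u * (F u t - G u t)) * k r u"
            by (simp add: algebra_simps)
          also have "\<bar>\<dots>\<bar> \<le> (\<bar>F r u - G r u\<bar> * \<bar>F u t\<bar> + \<bar>G r u\<bar> * \<bar>F u t - G u t\<bar>) * \<bar>k r u\<bar>"
            unfolding abs_mult by (intro mult_right_mono abs_triangle_ineq[THEN order_trans]) (auto simp: abs_mult)
          also have "\<dots> \<le> (N * exp (l * (r - t)) * A + A * (N * exp (l * (r - t)))) * B"
            using d r u st A0 B \<open>0 \<le> N\<close> nonneg[of r u] bd[of r u]
            by (intro mult_mono add_mono FA GA) (auto intro!: add_nonneg_nonneg)
          finally show ?thesis by (simp add: algebra_simps)
        qed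
        have "J F r - J G r = (LINT u:{t..r}|lborel. F r u * F u t * k r u - G r u * G u t * k r u)"
          unfolding J_def using int_F[OF r] int_G[OF r] by simp
        also have "\<bar>\<dots>\<bar> \<le> 2 * A * B * N * exp (l * (r - t)) * (r - t)"
          using r ineq by (intro abs_set_integral_Icc_le) auto
        also have "\<dots> \<le> 2 * A * B * N * exp (l * (r - t)) * X"
          using r st A0 B \<open>0 \<le> N\<close> by (intro mult_left_mono) auto
        finally show ?thesis by (simp add: algebra_simps)
      qed
      have exp_int: "(LINT r:{t..s}|lborel. ?c * exp (l * (r - t))) = ?c * exp (l * (s - t)) / l - ?c / l"
      proof -
        have "(LINT r|lborel. ?c * exp (l * (r - t)) * indicator {t..s} r)
            = ?c * exp (l * (s - t)) / l - ?c * exp (l * (t - t)) / l"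
          using l by (intro integral_FTC_Icc_real st(2)) (auto intro!: derivative_eq_intros)
        moreover have "(LINT r:{t..s}|lborel. ?c * exp (l * (r - t)))
            = (LINT r|lborel. ?c * exp (l * (r - t)) * indicator {t..s} r)"
          unfolding set_lebesgue_integral_def by (intro Bochner_Integration.integral_cong) auto
        ultimately show ?thesis by simp
      qed
      have "F s t = 1 + (LINT r:{t..s}|lborel. J F r)" "G s t = 1 + (LINT r:{t..s}|lborel. J G r)"
        unfolding J_def using st by (auto intro: sol(3)[OF F] sol(3)[OF G])
      then have "F s t - G s t = (LINT r:{t..s}|lborel. J F r - J G r)"
        using J_int by simp
      also have "\<bar>\<dots>\<bar> \<le> (LINT r:{t..s}|lborel. \<bar>J F r - J G r\<bar>)"
        using set_integral_norm_bound[of lborel "{t..s}" "\<lambda>r. J F r - J G r"] J_int by simp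
      also have "\<dots> \<le> (LINT r:{t..s}|lborel. ?c * exp (l * (r - t)))"
      proof (intro set_integral_mono set_integrable_abs set_integral_diff(1) J_int)
        show "set_integrable lborel {t..s} (\<lambda>r. ?c * exp (l * (r - t)))"
          by (intro borel_integrable_atLeastAtMost' continuous_intros)
      qed (rule J_diff)
      also have "\<dots> \<le> ?c * exp (l * (s - t)) / l"
        unfolding exp_int using l A0 B X0 \<open>0 \<le> N\<close> by simp
      also have "\<dots> = N * exp (l * (s - t)) * (2 * A * B * X / l)"
        by simp
      also have "\<dots> \<le> N * exp (l * (s - t)) * (1 / 2)"
        using l \<open>0 \<le> N\<close> by (intro mult_left_mono) (auto simp: divide_simps l_def algebra_simps)
      finally show ?thesis by simp
    qed
    have "\<bar>F s t - G s t\<bar> \<le> 2 * A / 2 ^ n * exp (l * (s - t))" if "0 \<le> t" "t \<le> s" "s \<le> X" for n s t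
      using that
    proof (induction n arbitrary: s t)
      case 0
      have "2 * A * 1 \<le> 2 * A * exp (l * (s - t))" using A0 l 0 by (intro mult_left_mono) auto
      then show ?case using FA[OF 0] GA[OF 0] by simp
    next
      case (Suc n)
      show ?case using step[OF Suc.IH _ Suc.prems] A0 by simp
    qed
    then have "\<bar>F s t - G s t\<bar> \<le> 2 * A / 2 ^ n * exp (l * (s - t))" for n
      using st by (simp add: X_def)
    moreover have "(\<lambda>n. 2 * A / 2 ^ n * exp (l * (s - t))) \<longlonglongrightarrow> 0 * exp (l * (s - t))"
      by (intro tendsto_mult tendsto_const LIMSEQ_divide_realpow_zero) auto
    ultimately have "\<bar>F s t - G s t\<bar> \<le> 0"
      by (intro LIMSEQ_le_const) auto
    then show ?thesis by simp
  qed
  moreover have "F s t = G s t" if "\<not> (0 \<le> t \<and> t \<le> s)" for s t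
    using F G that unfolding kraichnan_solution_def by metis
  ultimately show ?thesis by (intro ext) blast
qed

section \<open>Growth rates of supermultiplicative functions\<close>

text \<open>Fekete's argument, uniform in the starting point: fit as many blocks of length
  \<open>M\<close> as possible into the interval and use that the remaining piece contributes a
  factor of at least 1. If \<open>L - e \<le> 0\<close>, the bound \<open>1 \<le> H\<close> already
  suffices.\<close>

lemma supermultiplicative_growth_lower:
  fixes H :: "real \<Rightarrow> real \<Rightarrow> real"
  assumes one: "\<And>s t. 0 \<le> t \<Longrightarrow> t \<le> s \<Longrightarrow> 1 \<le> H s t"
    and super: "\<And>s v t. 0 \<le> t \<Longrightarrow> t \<le> v \<Longrightarrow> v \<le> s \<Longrightarrow> H s v * H v t \<le> H s t"
    and block: "\<And>e. 0 < e \<Longrightarrow> \<exists>M>0. \<exists>T\<ge>0. \<forall>t\<ge>T. (L - e) * M \<le> ln (H (t + M) t)"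
    and "0 < e"
  shows "\<exists>T\<ge>0. \<exists>U>0. \<forall>t\<ge>T. \<forall>u\<ge>U. L - e \<le> ln (H (t + u) t) / u"
proof (cases "L - e \<le> 0")
  case True
  have "L - e \<le> ln (H (t + u) t) / u" if "0 \<le> t" "1 \<le> u" for t u
  proof -
    have "0 \<le> ln (H (t + u) t) / u"
      using one[of t "t + u"] that by simp
    with True show ?thesis by linarith
  qed
  then show ?thesis by (intro exI[of _ 0] conjI exI[of _ 1]) auto
next
  case False
  have ln_super: "ln (H s v) + ln (H v t) \<le> ln (H s t)" if "0 \<le> t" "t \<le> v" "v \<le> s" for s v t
  proof -
    have "0 < H s v" "0 < H v t" "0 < H s t"
      using one[of v s] one[of t v] one[of t s] that by auto
    then show ?thesis
      using super[OF that] by (simp flip: ln_mult_pos)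
  qed
  obtain M T where M: "0 < M" "0 \<le> T" and MT: "\<And>t. T \<le> t \<Longrightarrow> (L - e / 2) * M \<le> ln (H (t + M) t)"
    using block[of "e / 2"] \<open>0 < e\<close> by auto
  define w where "w = (L - e / 2) * M"
  have w: "0 < w" using False \<open>0 < e\<close> M by (simp add: w_def)
  have blocks: "real n * w \<le> ln (H (t + real n * M) t)" if "T \<le> t" for n t
  proof (induction n)
    case 0
    then show ?case using one[of t t] M that by simp
  next
    case (Suc n)
    have "w \<le> ln (H (t + real n * M + M) (t + real n * M))"
      unfolding w_def using that M by (intro MT) (simp add: add_increasing2)
    then show ?case
      using Suc ln_super[of t "t + real n * M" "t + real n * M + M"] M that
      by (simp add: algebra_simps)
  qed
  \<comment> \<open>Rounding \<open>u / M\<close> down loses at most one block, worth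
    \<open>w\<close>; beyond \<open>U\<close> this is covered by the slack \<open>e / 2 * u\<close>
    left by applying \<open>block\<close> to \<open>e / 2\<close>.\<close>
  define U where "U = max 1 (2 * w / e)"
  have "L - e \<le> ln (H (t + u) t) / u" if t: "T \<le> t" and u: "U \<le> u" for t u
  proof -
    have u0: "0 < u" using u by (simp add: U_def)
    define n where "n = nat \<lfloor>u / M\<rfloor>"
    have "real n = of_int \<lfloor>u / M\<rfloor>" using u0 M by (simp add: n_def)
    then have n: "real n \<le> u / M" "u / M - 1 \<le> real n" by linarith+
    have nM: "real n * M \<le> u" using n(1) M by (simp add: field_simps)
    have "(u / M - 1) * w \<le> real n * w" using n(2) w by (intro mult_right_mono) auto
    also have "\<dots> \<le> ln (H (t + u) (t + real n * M)) + ln (H (t + real n * M) t)"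
    proof -
      have "1 \<le> H (t + u) (t + real n * M)" using nM t M by (intro one) auto
      then have "0 \<le> ln (H (t + u) (t + real n * M))" by simp
      then show ?thesis using blocks[OF t, of n] by linarith
    qed
    also have "\<dots> \<le> ln (H (t + u) t)"
      using nM t M by (intro ln_super) auto
    finally have "(u / M - 1) * w \<le> ln (H (t + u) t)" .
    moreover have "(u / M - 1) * w = (L - e) * u + (e / 2 * u - w)"
      using M by (simp add: w_def field_simps)
    moreover have "w \<le> e / 2 * u"
      using u \<open>0 < e\<close> by (simp add: U_def field_simps)
    ultimately show ?thesis using u0 by (simp add: field_simps)
  qed
  then show ?thesis using M by (intro exI[of _ T] conjI exI[of _ U]) (auto simp: U_def)
qed

text \<open>The lower bound is uniform in \<open>t \<ge> T\<close> and \<open>u \<ge> U\<close>,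
  which with \<open>upper\<close> gives the joint limit. For the iterated limit, the inner limit
  equals \<open>L\<close> for every \<open>t > 0\<close>, because a fixed initial piece does not
  affect the rate.\<close>

lemma supermultiplicative_has_growth_rate:
  fixes H :: "real \<Rightarrow> real \<Rightarrow> real"
  assumes one: "\<And>s t. 0 \<le> t \<Longrightarrow> t \<le> s \<Longrightarrow> 1 \<le> H s t"
    and super: "\<And>s v t. 0 \<le> t \<Longrightarrow> t \<le> v \<Longrightarrow> v \<le> s \<Longrightarrow> H s v * H v t \<le> H s t"
    and block: "\<And>e. 0 < e \<Longrightarrow> \<exists>M>0. \<exists>T\<ge>0. \<forall>t\<ge>T. (L - e) * M \<le> ln (H (t + M) t)"
    and upper: "\<And>t u. 0 < t \<Longrightarrow> 0 < u \<Longrightarrow> ln (H (t + u) t) \<le> L * u"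
  shows "has_growth_rate H L"
proof -
  note lower = supermultiplicative_growth_lower[of H L, OF one super block]
  have upper': "ln (H (t + u) t) / u \<le> L" if "0 < t" "0 < u" for t u
    using upper[OF that] that by (simp add: field_simps)
  have "((\<lambda>(t, u). ln (H (t + u) t) / u) \<longlongrightarrow> L) (at_top \<times>\<^sub>F at_top)"
  proof (rule tendstoI)
    fix e :: real assume "0 < e"
    then obtain T U where TU: "0 \<le> T" "0 < U"
        "\<And>t u. T \<le> t \<Longrightarrow> U \<le> u \<Longrightarrow> L - e / 2 \<le> ln (H (t + u) t) / u"
      using lower[of "e / 2"] by auto
    have "\<forall>\<^sub>F (t, u) in at_top \<times>\<^sub>F at_top. T + 1 \<le> t \<and> U \<le> u"
      by (intro eventually_prodI[of "\<lambda>t. T + 1 \<le> t" _ "\<lambda>u. U \<le> u", THEN eventually_mono] eventually_ge_at_top) auto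
    then show "\<forall>\<^sub>F x in at_top \<times>\<^sub>F at_top. dist (case x of (t, u) \<Rightarrow> ln (H (t + u) t) / u) L < e"
    proof (rule eventually_mono, clarify)
      fix t u assume "T + 1 \<le> t" "U \<le> u"
      then have "L - e / 2 \<le> ln (H (t + u) t) / u" "ln (H (t + u) t) / u \<le> L"
        using TU by (auto intro!: upper')
      then show "dist (ln (H (t + u) t) / u) L < e"
        using \<open>0 < e\<close> by (simp add: dist_real_def)
    qed
  qed
  moreover have "((\<lambda>u. ln (H (t + u) t) / u) \<longlongrightarrow> L) at_top" if t: "0 < t" for t
  proof (rule tendstoI)
    fix e :: real assume "0 < e"
    then obtain T U where TU: "0 \<le> T" "0 < U"
        "\<And>t u. T \<le> t \<Longrightarrow> U \<le> u \<Longrightarrow> L - e / 4 \<le> ln (H (t + u) t) / u"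
      using lower[of "e / 4"] by auto
    \<comment> \<open>Here \<open>t\<close> is fixed while \<open>T\<close> depends on
      \<open>e\<close>, so \<open>T\<close> may exceed \<open>t\<close>. Starting at
      \<open>T'\<close> instead costs only the length \<open>d\<close>, which is independent of
      \<open>u\<close>.\<close>
    define T' where "T' = max t T"
    define d where "d = T' - t"
    \<comment> \<open>The first bound puts \<open>u - d\<close> beyond \<open>U\<close>; the second
      makes the loss \<open>(L - e / 4) * d\<close> at most \<open>e / 4 * u\<close>.\<close>
    have "\<forall>\<^sub>F u in at_top. U + d \<le> u \<and> 4 * (L - e / 4) * d / e \<le> u"
      by (intro eventually_conj eventually_ge_at_top)
    then show "\<forall>\<^sub>F u in at_top. dist (ln (H (t + u) t) / u) L < e"
    proof (rule eventually_mono, elim conjE)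
      fix u assume u: "U + d \<le> u" "4 * (L - e / 4) * d / e \<le> u"
      have d: "0 \<le> d" "t \<le> T'" "T \<le> T'" by (auto simp: d_def T'_def)
      have u0: "0 < u" "T' \<le> t + u" using u TU d by (auto simp: d_def)
      have "L - e / 4 \<le> ln (H (T' + (u - d)) T') / (u - d)"
        using u d by (intro TU) auto
      then have "(L - e / 4) * (u - d) \<le> ln (H (t + u) T')"
        using u TU(2) by (simp add: d_def field_simps)
      also have "\<dots> \<le> ln (H (t + u) t)"
      proof -
        have 1: "1 \<le> H (t + u) T'" "1 \<le> H T' t" using t d u0 by (auto intro!: one)
        have "H (t + u) T' * 1 \<le> H (t + u) T' * H T' t" using 1 by (intro mult_left_mono) auto
        also have "\<dots> \<le> H (t + u) t" using t d u0 by (intro super) auto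
        finally show ?thesis using 1 by simp
      qed
      finally have "(L - e / 4) * (u - d) \<le> ln (H (t + u) t)" .
      moreover have "(L - e / 4) * d \<le> e / 4 * u" using u(2) \<open>0 < e\<close> by (simp add: field_simps)
      moreover have "(L - 2 * x) * u = (L - x) * (u - d) + (L - x) * d - x * u" for x
        by (simp add: algebra_simps)
      from this[of "e / 4"] have "(L - e / 2) * u = (L - e / 4) * (u - d) + (L - e / 4) * d - e / 4 * u"
        by simp
      ultimately have "(L - e / 2) * u \<le> ln (H (t + u) t)" by linarith
      then have "L - e / 2 \<le> ln (H (t + u) t) / u" using u0 by (simp add: field_simps)
      with upper'[OF t u0(1)] \<open>0 < e\<close> show "dist (ln (H (t + u) t) / u) L < e"
        by (simp add: dist_real_def)
    qed
  qed
  then have "\<forall>\<^sub>F t in at_top. ((\<lambda>u. ln (H (t + u) t) / u) \<longlongrightarrow> L) at_top"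
    by (intro eventually_mono[OF eventually_gt_at_top[of 0]])
  ultimately show ?thesis
    unfolding has_growth_rate_def by (auto intro!: exI[of _ "\<lambda>_. L"])
qed

section \<open>The abscissa of convergence\<close>

text \<open>For \<open>l > L\<close> the integrand is dominated by a decaying exponential; for
  \<open>l < L\<close> it is at least 1 from some point on. The infimum is thus \<open>L\<close>,
  whatever happens at \<open>l = L\<close>.\<close>

lemma lambda_c_eqI:
  fixes H :: "real \<Rightarrow> real"
  assumes upper: "\<And>u. 0 \<le> u \<Longrightarrow> H u \<le> exp (L * u)"
    and lower: "\<And>e. 0 < e \<Longrightarrow> \<exists>U\<ge>0. \<forall>u\<ge>U. exp ((L - e) * u) \<le> H u"
  shows "lambda_c H = ereal L"
  unfolding lambda_c_def
proof (rule antisym)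
  let ?S = "{l. (\<integral>\<^sup>+u\<in>{0..}. ennreal (exp (- l * u) * H u) \<partial>lborel) < \<infinity>}"
  have "L + e \<in> ?S" if "0 < e" for e
  proof -
    have "(\<integral>\<^sup>+u\<in>{0..}. ennreal (exp (- (L + e) * u) * H u) \<partial>lborel)
        \<le> (\<integral>\<^sup>+u. ennreal (exp (- e * u)) * indicator {0..} u \<partial>lborel)"
    proof (rule nn_integral_mono)
      fix u :: real
      have "exp (- (L + e) * u) * H u \<le> exp (- (L + e) * u) * exp (L * u)" if "0 \<le> u"
        using upper[OF that] by (intro mult_left_mono) auto
      then show "ennreal (exp (- (L + e) * u) * H u) * indicator {0..} u
          \<le> ennreal (exp (- e * u)) * indicator {0..} u"
        by (auto split: split_indicator simp: exp_add[symmetric] algebra_simps intro!: ennreal_leI)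
    qed
    also have "\<dots> = ennreal (0 - (- exp (- e * 0) / e))"
    proof (rule nn_integral_FTC_atLeast)
      show "((\<lambda>u. - exp (- e * u) / e) has_real_derivative exp (- e * u)) (at u)" for u
        using that by (auto intro!: derivative_eq_intros)
      have "filterlim (\<lambda>u. - e * u) at_bot at_top"
        using that by (intro filterlim_tendsto_neg_mult_at_bot[OF tendsto_const] filterlim_ident) auto
      then have "((\<lambda>u. exp (- e * u)) \<longlongrightarrow> 0) at_top"
        by (rule filterlim_compose[OF exp_at_bot])
      then show "((\<lambda>u. - exp (- e * u) / e) \<longlongrightarrow> 0) at_top"
        using tendsto_divide[OF tendsto_minus tendsto_const[of e], of _ 0] that by simp
    qed auto
    also have "\<dots> < \<infinity>" by simp
    finally show ?thesis by (simp only: mem_Collect_eq)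
  qed
  then have "Inf (ereal ` ?S) \<le> ereal L + ereal e" if "0 < e" for e
    using that by (auto intro!: Inf_lower)
  then show "Inf (ereal ` ?S) \<le> ereal L"
    by (rule ereal_le_epsilon2)
  show "ereal L \<le> Inf (ereal ` ?S)"
  proof (rule Inf_greatest, safe)
    fix l assume fin: "(\<integral>\<^sup>+u\<in>{0..}. ennreal (exp (- l * u) * H u) \<partial>lborel) < \<infinity>"
    show "ereal L \<le> ereal l"
    proof (rule ccontr)
      assume "\<not> ereal L \<le> ereal l"
      then have l: "l < L" by simp
      obtain U where U: "0 \<le> U" "\<And>u. U \<le> u \<Longrightarrow> exp ((L - (L - l)) * u) \<le> H u"
        using lower[of "L - l"] l by auto
      \<comment> \<open>An integrand that is at least 1 on \<open>{U..U + x}\<close> for every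
        \<open>x\<close> makes the integral exceed every real number.\<close>
      have "ennreal x \<le> (\<integral>\<^sup>+u\<in>{0..}. ennreal (exp (- l * u) * H u) \<partial>lborel)" if "0 \<le> x" for x
      proof -
        have "ennreal x = (\<integral>\<^sup>+u. indicator {U..U + x} u \<partial>lborel)"
          using that by simp
        also have "\<dots> \<le> (\<integral>\<^sup>+u\<in>{0..}. ennreal (exp (- l * u) * H u) \<partial>lborel)"
        proof (rule nn_integral_mono)
          fix u :: real
          have "1 \<le> exp (- l * u) * H u" if "U \<le> u"
          proof -
            have "1 = exp (- l * u) * exp (l * u)" by (simp flip: exp_add)
            also have "\<dots> \<le> exp (- l * u) * H u" using U(2)[OF that] by (intro mult_left_mono) auto
            finally show ?thesis .
          qed
          then show "indicator {U..U + x} u \<le> ennreal (exp (- l * u) * H u) * indicator {0..} u"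
            using U(1) by (auto split: split_indicator)
        qed
        finally show ?thesis .
      qed
      moreover obtain y where "0 \<le> y" "(\<integral>\<^sup>+u\<in>{0..}. ennreal (exp (- l * u) * H u) \<partial>lborel) = ennreal y"
        using fin by (auto simp: less_top_ennreal)
      ultimately have "ennreal (y + 1) \<le> ennreal y" by (metis add_nonneg_nonneg zero_le_one)
      then show False using \<open>0 \<le> y\<close> by simp
    qed
  qed
qed

section \<open>Dependence of the solution on the kernel\<close>

text \<open>The equation evaluates the kernel only at \<open>r \<ge> u \<ge> t \<ge> 0\<close>. This
  permits replacing a kernel by an extension that is well behaved on the whole plane.\<close>

lemma kraichnan_solution_cong:
  assumes eq: "\<And>s t. 0 \<le> t \<Longrightarrow> t \<le> s \<Longrightarrow> k s t = k' s t"
  shows "kraichnan_solution k H \<longleftrightarrow> kraichnan_solution k' H"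
proof -
  have "(LINT r:{t..s}|lborel. LINT u:{t..r}|lborel. H r u * H u t * k r u)
      = (LINT r:{t..s}|lborel. LINT u:{t..r}|lborel. H r u * H u t * k' r u)" if "0 \<le> t" for s t
    unfolding set_lebesgue_integral_def using that eq
    by (intro Bochner_Integration.integral_cong refl) (auto split: split_indicator intro!: Bochner_Integration.integral_cong)
  then show ?thesis unfolding kraichnan_solution_def by auto
qed

lemma kraichnan_H_cong:
  assumes "\<And>s t. 0 \<le> t \<Longrightarrow> t \<le> s \<Longrightarrow> k s t = k' s t"
  shows "kraichnan_H k = kraichnan_H k'"
proof -
  have "kraichnan_solution k = kraichnan_solution k'"
    by (intro ext kraichnan_solution_cong assms)
  then show ?thesis by (simp add: kraichnan_H_def)
qed

text \<open>The conditions range over the whole plane because the iterates are defined there; a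
  kernel known only on the quadrant enters through its extension by 0.\<close>

locale bounded_kernel =
  fixes k :: "real \<Rightarrow> real \<Rightarrow> real" and B :: real
  assumes meas: "(\<lambda>(s, t). k s t) \<in> borel_measurable borel"
    and nonneg: "\<And>s t. 0 \<le> k s t"
    and bounded: "\<And>s t. k s t \<le> B"
begin

abbreviation K :: "real \<Rightarrow> real \<Rightarrow> ennreal" where
  "K \<equiv> \<lambda>s t. ennreal (k s t)"

lemma B_nonneg: "0 \<le> B"
  using nonneg[of 0 0] bounded[of 0 0] by linarith

lemma K_measurable: "case_prod K \<in> borel_measurable (borel \<Otimes>\<^sub>M borel)"
proof -
  have [measurable]: "case_prod k \<in> borel_measurable (borel \<Otimes>\<^sub>M borel)"
    using meas by (simp add: borel_prod)
  show ?thesis by measurable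
qed

lemma K_le: "K s t \<le> ennreal B"
  by (intro ennreal_leI bounded)

lemma kraichnan_H_eq: "kraichnan_H k = kraichnan_fun k"
  unfolding kraichnan_H_def
  using kraichnan_solution_kraichnan_fun[OF meas nonneg bounded]
    kraichnan_solution_unique[OF meas nonneg bounded] by (intro the_equality) blast+

lemma sup_exp_bound: "t \<le> s \<Longrightarrow> kraichnan_sup K s t \<le> ennreal (exp ((4 * B + 2) * (s - t)))"
  by (rule kraichnan_sup_exp_bound[where K = K, OF B_nonneg K_le])

lemma ennreal_kraichnan_H:
  assumes "0 \<le> t" "t \<le> s"
  shows "ennreal (kraichnan_H k s t) = kraichnan_sup K s t"
proof -
  have "kraichnan_sup K s t < top"
    by (rule le_less_trans[OF sup_exp_bound[OF assms(2)] ennreal_less_top])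
  then show ?thesis using assms by (simp add: kraichnan_H_eq kraichnan_fun_def)
qed

lemma kraichnan_H_nonneg: "0 \<le> kraichnan_H k s t"
  by (simp add: kraichnan_H_eq kraichnan_fun_def)

lemma one_le_kraichnan_H: "0 \<le> t \<Longrightarrow> t \<le> s \<Longrightarrow> 1 \<le> kraichnan_H k s t"
  using one_le_kraichnan_sup[of K s t] kraichnan_H_nonneg[of s t]
  by (simp flip: ennreal_kraichnan_H ennreal_1)

lemma kraichnan_H_supermult:
  assumes "0 \<le> t" "t \<le> v" "v \<le> s"
  shows "kraichnan_H k s v * kraichnan_H k v t \<le> kraichnan_H k s t"
  using kraichnan_sup_supermult[OF K_measurable assms(2,3)] assms kraichnan_H_nonneg
  by (simp add: mult_nonneg_nonneg ennreal_mult[symmetric] flip: ennreal_kraichnan_H)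

lemma kraichnan_H_exp_bound:
  assumes "0 \<le> t" "t \<le> s"
  shows "kraichnan_H k s t \<le> exp ((4 * B + 2) * (s - t))"
  using sup_exp_bound[OF assms(2)] assms by (simp flip: ennreal_kraichnan_H)

lemma kraichnan_H_translate:
  assumes stat: "\<And>s t a. k (s + a) (t + a) = k s t" and "0 \<le> t" "0 \<le> u"
  shows "kraichnan_H k (t + u) t = kraichnan_H k u 0"
proof -
  have "kraichnan_sup K (u + t) (0 + t) = kraichnan_sup K u 0"
    unfolding kraichnan_sup_def using kraichnan_iter_translate[OF K_measurable, of t _ u 0] stat by simp
  then show ?thesis
    using assms kraichnan_H_nonneg by (simp add: add.commute flip: ennreal_kraichnan_H)
qed

lemma kraichnan_H_mono_kernel:
  assumes "bounded_kernel k' B'" "0 \<le> t" "t \<le> s"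
    and "\<And>u r. t \<le> u \<Longrightarrow> u \<le> r \<Longrightarrow> r \<le> s \<Longrightarrow> k r u \<le> k' r u"
  shows "kraichnan_H k s t \<le> kraichnan_H k' s t"
proof -
  interpret k': bounded_kernel k' B' by fact
  have "kraichnan_sup K s t \<le> kraichnan_sup k'.K s t"
    unfolding kraichnan_sup_def
    by (intro SUP_mono' kraichnan_iter_mono_kernel ennreal_leI assms(4))
  then show ?thesis
    using assms kraichnan_H_nonneg k'.kraichnan_H_nonneg
    by (simp flip: ennreal_kraichnan_H k'.ennreal_kraichnan_H)
qed

text \<open>A Picard iterate is a polynomial in the kernel, so it nearly attains its value at \<open>k\<close> already
  at \<open>\<theta> k\<close>, uniformly over all larger kernels.\<close>

lemma kraichnan_H_lower_semicontinuous:
  assumes stat: "\<And>s t a. k (s + a) (t + a) = k s t" and "0 \<le> M" and v: "exp v < kraichnan_H k M 0"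
  obtains \<theta> where "0 < \<theta>" "\<theta> < 1"
    "\<And>k' B' t. bounded_kernel k' B' \<Longrightarrow> 0 \<le> t \<Longrightarrow>
      (\<And>u r. t \<le> u \<Longrightarrow> u \<le> r \<Longrightarrow> r \<le> t + M \<Longrightarrow> \<theta> * k r u \<le> k' r u) \<Longrightarrow>
      exp v \<le> kraichnan_H k' (t + M) t"
proof -
  have "ennreal (exp v) < kraichnan_sup K M 0"
    using v assms(2) by (simp flip: ennreal_kraichnan_H add: ennreal_less_iff)
  \<comment> \<open>A strict inequality for the supremum is already attained by some iterate, to
    which scaling of the kernel applies.\<close>
  then obtain n where n: "ennreal (exp v) < kraichnan_iter K n M 0"
    unfolding kraichnan_sup_def less_SUP_iff by blast
  have "kraichnan_iter K n M 0 < top"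
    using kraichnan_iter_le_sup[of K n M 0] sup_exp_bound[OF assms(2)] ennreal_less_top
    by (meson le_less_trans)
  then obtain p where p: "kraichnan_iter K n M 0 = ennreal p" "0 \<le> p"
    by (cases "kraichnan_iter K n M 0") auto
  have vp: "exp v < p" using n p by (simp add: ennreal_less_iff)
  then have "0 < p" using exp_gt_zero[of v] by linarith
  define m :: nat where "m = 2 ^ n - 1"
  define c where "c = ln p - v"
  have "v < ln p" using vp \<open>0 < p\<close> by (metis ln_exp ln_less_cancel_iff exp_gt_zero)
  then have c: "0 < c" by (simp add: c_def)
  \<comment> \<open>\<open>c\<close> is the logarithmic slack of the iterate over
    \<open>exp v\<close>; this choice gives \<open>\<theta> ^ m \<ge> exp (- c)\<close>, with
    \<open>m + 1\<close> in place of \<open>m\<close> to avoid division by 0.\<close>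
  define \<theta> where "\<theta> = exp (- (c / (real m + 1)))"
  have \<theta>: "0 < \<theta>" "\<theta> < 1" using c by (auto simp: \<theta>_def)
  have "exp v = exp (- c) * p" using \<open>0 < p\<close> by (simp add: c_def exp_diff)
  also have "exp (- c) \<le> \<theta> ^ m"
    using c by (simp add: \<theta>_def field_simps flip: exp_of_nat_mult)
  finally have \<theta>p: "exp v \<le> \<theta> ^ m * p" using \<open>0 \<le> p\<close> by (simp add: mult_right_mono)
  show thesis
  proof (rule that[OF \<theta>])
    fix k' B' t
    assume k': "bounded_kernel k' B'" and t: "0 \<le> t"
      and le: "\<And>u r. t \<le> u \<Longrightarrow> u \<le> r \<Longrightarrow> r \<le> t + M \<Longrightarrow> \<theta> * k r u \<le> k' r u"
    interpret k': bounded_kernel k' B' by fact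
    have "ennreal (exp v) \<le> ennreal \<theta> ^ m * kraichnan_iter K n M 0"
      using \<theta>p \<theta> p by (simp add: ennreal_power flip: ennreal_mult)
    also have "kraichnan_iter K n M 0 = kraichnan_iter K n (t + M) t"
      using kraichnan_iter_translate[OF K_measurable, of t n M 0] stat by (simp add: add.commute)
    also have "ennreal \<theta> ^ m * \<dots> \<le> kraichnan_iter (\<lambda>s t. ennreal \<theta> * K s t) n (t + M) t"
      unfolding m_def using \<theta> by (intro kraichnan_iter_scale K_measurable) (simp add: ennreal_le_1)
    also have "\<dots> \<le> kraichnan_iter k'.K n (t + M) t"
      using le \<theta> nonneg by (intro kraichnan_iter_mono_kernel) (simp add: ennreal_leI flip: ennreal_mult)
    also have "\<dots> \<le> kraichnan_sup k'.K (t + M) t" by (rule kraichnan_iter_le_sup)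
    also have "\<dots> = ennreal (kraichnan_H k' (t + M) t)"
      using t assms(2) by (intro k'.ennreal_kraichnan_H[symmetric]) auto
    finally show "exp v \<le> kraichnan_H k' (t + M) t"
      by (simp add: k'.kraichnan_H_nonneg)
  qed
qed

end

section \<open>Comparison with the stationary kernel\<close>

theorem theorem1p2:
  fixes k h :: "real \<Rightarrow> real \<Rightarrow> real" and k1 :: "real \<Rightarrow> real"
    and C :: real and \<delta> :: "real \<Rightarrow> real \<Rightarrow> real"
  assumes cov: "covariance_kernel k"
    and meas: "(\<lambda>(s, t). k s t) \<in> borel_measurable (restrict_space borel ({0..} \<times> {0..}))"
    and nonneg: "\<And>s t. 0 \<le> s \<Longrightarrow> 0 \<le> t \<Longrightarrow> 0 \<le> k s t"
    and bounded: "\<exists>B. \<forall>s\<ge>0. \<forall>t\<ge>0. k s t \<le> B"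
    and decomp: "\<And>s t. 0 \<le> t \<Longrightarrow> t \<le> s \<Longrightarrow> k s t = k1 (s - t) + h s t"
    and k1_nonneg: "\<And>x. 0 \<le> x \<Longrightarrow> 0 \<le> k1 x"
    and h_nonneg: "\<And>s t. 0 \<le> t \<Longrightarrow> t \<le> s \<Longrightarrow> 0 \<le> h s t"
    and h_sym: "\<And>s t. 0 \<le> s \<Longrightarrow> 0 \<le> t \<Longrightarrow> h s t = h t s"
    and C_pos: "0 < C"
    and \<delta>_lim: "\<And>M. 0 < M \<Longrightarrow> ((\<lambda>T. \<delta> M T) \<longlongrightarrow> 0) at_top"
    and h_close: "\<And>M T s t. 0 < M \<Longrightarrow> 0 < T \<Longrightarrow> T \<le> t \<Longrightarrow> 0 \<le> s \<Longrightarrow> \<bar>s - t\<bar> \<le> M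
                    \<Longrightarrow> \<bar>h s t - C\<bar> \<le> \<delta> M T"
    and h_bound: "\<And>T s t. 0 < T \<Longrightarrow> T \<le> t \<Longrightarrow> t \<le> s \<Longrightarrow> \<bar>h s t\<bar> \<le> C"
  shows "\<exists>L. has_growth_rate (kraichnan_H k) L \<and>
             has_growth_rate (kraichnan_H (stationary_kernel C k1)) L \<and>
             lambda_c (\<lambda>u. kraichnan_H (stationary_kernel C k1) u 0) = ereal L"
proof -
  obtain B where B: "\<And>s t. 0 \<le> s \<Longrightarrow> 0 \<le> t \<Longrightarrow> k s t \<le> B" using bounded by blast
  have B0: "0 \<le> B" using B[of 0 0] nonneg[of 0 0] by simp
  \<comment> \<open>The values of \<open>k\<close> off the quadrant are arbitrary, and the
    decomposition speaks only about \<open>s \<ge> t\<close>; \<open>kt\<close> keeps exactly the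
    values that enter the equation.\<close>
  define kt where "kt = (\<lambda>s t. if 0 \<le> t \<and> t \<le> s then k s t else 0)"
  let ?\<kappa> = "stationary_kernel C k1"
  have [measurable]: "(\<lambda>x. indicator ({0..} \<times> {0..}) x *\<^sub>R (case x of (s, t) \<Rightarrow> k s t))
      \<in> borel_measurable (borel \<Otimes>\<^sub>M borel)"
    using meas unfolding borel_prod
    by (subst (asm) borel_measurable_restrict_space_iff) (auto intro!: borel_closed closed_Times)
  have kt_eq: "kt = (\<lambda>s t. if t \<le> s then indicator ({0..} \<times> {0..}) (s, t) *\<^sub>R (case (s, t) of (s, t) \<Rightarrow> k s t) else 0)"
    by (auto simp: kt_def fun_eq_iff)
  have kt_meas[measurable]: "case_prod kt \<in> borel_measurable (borel \<Otimes>\<^sub>M borel)"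
    unfolding kt_eq by measurable
  \<comment> \<open>This recovers the measurability of \<open>k1\<close>: far from the origin
    \<open>h\<close> is close to \<open>C\<close>, so \<open>k1\<close> is a pointwise limit of
    measurable sections of \<open>kt\<close>.\<close>
  have k1_lim: "(\<lambda>n. kt (real n + x) (real n) - C) \<longlonglongrightarrow> k1 x" if "0 \<le> x" for x
  proof -
    have "((\<lambda>n. h (real n + x) (real n) - C) \<longlongrightarrow> 0) sequentially"
    proof (rule Lim_null_comparison)
      \<comment> \<open>\<open>x + 1\<close> is a positive bound on the distance \<open>x\<close>,
        also for \<open>x = 0\<close>.\<close>
      show "\<forall>\<^sub>F n in sequentially. norm (h (real n + x) (real n) - C) \<le> \<delta> (x + 1) (real n)"
        using eventually_gt_at_top[of 0]
        by eventually_elim (use that in \<open>auto intro!: h_close\<close>)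
      show "(\<lambda>n. \<delta> (x + 1) (real n)) \<longlonglongrightarrow> 0"
        using that by (intro filterlim_compose[OF \<delta>_lim filterlim_real_sequentially]) auto
    qed
    then have "((\<lambda>n. k1 x + (h (real n + x) (real n) - C)) \<longlongrightarrow> k1 x + 0) sequentially"
      by (intro tendsto_add tendsto_const)
    then show ?thesis using that by (simp add: kt_def decomp algebra_simps)
  qed
  have [measurable]: "(\<lambda>x. k1 \<bar>x\<bar>) \<in> borel_measurable borel"
    by (rule borel_measurable_LIMSEQ_real[where u = "\<lambda>n x. kt (real n + \<bar>x\<bar>) (real n) - C"])
      (auto intro: k1_lim)
  have k1_le: "k1 x \<le> B" if "0 \<le> x" for x
    using decomp[of 0 x] B[of x 0] h_nonneg[of 0 x] that by simp
  interpret kt: bounded_kernel kt B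
  proof
    show "(\<lambda>(s, t). kt s t) \<in> borel_measurable borel" using kt_meas by (simp add: borel_prod)
  qed (use B nonneg B0 in \<open>auto simp: kt_def\<close>)
  interpret \<kappa>: bounded_kernel ?\<kappa> "C + B"
  proof
    have "case_prod ?\<kappa> \<in> borel_measurable (borel \<Otimes>\<^sub>M borel)"
      unfolding stationary_kernel_def by measurable
    then show "(\<lambda>(s, t). ?\<kappa> s t) \<in> borel_measurable borel" by (simp add: borel_prod)
  qed (use C_pos k1_nonneg k1_le in \<open>auto simp: stationary_kernel_def intro!: add_nonneg_nonneg\<close>)
  have kt_H: "kraichnan_H k = kraichnan_H kt"
    by (rule kraichnan_H_cong) (simp add: kt_def)
  have stat: "?\<kappa> (s + a) (t + a) = ?\<kappa> s t" for s t a by (simp add: stationary_kernel_def)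
  define \<phi> where "\<phi> = (\<lambda>u. ln (kraichnan_H ?\<kappa> u 0))"
  have \<kappa>_ge: "1 \<le> kraichnan_H ?\<kappa> u 0" if "0 \<le> u" for u
    using that by (intro \<kappa>.one_le_kraichnan_H) auto
  have \<phi>: "kraichnan_H ?\<kappa> (t + u) t = exp (\<phi> u)" if "0 \<le> t" "0 \<le> u" for t u
    using \<kappa>_ge[OF that(2)] by (simp add: \<kappa>.kraichnan_H_translate[OF stat that] \<phi>_def)
  \<comment> \<open>The Fekete supremum: finite by the exponential bound, an upper bound for every
    \<open>u\<close>, and nearly attained by some block length \<open>M\<close>.\<close>
  define L where "L = (SUP u\<in>{0<..}. \<phi> u / u)"
  have bdd: "bdd_above ((\<lambda>u. \<phi> u / u) ` {0<..})"
  proof (rule bdd_aboveI2)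
    fix u :: real assume u: "u \<in> {0<..}"
    have "\<phi> u \<le> (4 * (C + B) + 2) * u"
      using \<kappa>.kraichnan_H_exp_bound[of 0 u] \<phi>[of 0 u] u by simp
    then show "\<phi> u / u \<le> 4 * (C + B) + 2" using u by (simp add: field_simps)
  qed
  have \<phi>_le: "\<phi> u \<le> L * u" if "0 \<le> u" for u
  proof (cases "u = 0")
    case True
    then show ?thesis using \<kappa>.kraichnan_H_exp_bound[of 0 0] \<phi>[of 0 0] by simp
  next
    case False
    then have "\<phi> u / u \<le> L" unfolding L_def using that by (intro cSUP_upper bdd) auto
    then show ?thesis using that False by (simp add: field_simps)
  qed
  have \<phi>_gt: "\<exists>M>0. (L - e) * M < \<phi> M" if "0 < e" for e
  proof -
    have "\<exists>M\<in>{0<..}. L - e < \<phi> M / M"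
      using less_cSUP_iff[OF _ bdd, of "L - e"] that unfolding L_def[symmetric] by auto
    then show ?thesis by (auto simp: field_simps)
  qed
  have block_\<kappa>: "\<exists>M>0. \<exists>T\<ge>0. \<forall>t\<ge>T. (L - e) * M \<le> ln (kraichnan_H ?\<kappa> (t + M) t)" if e: "0 < e" for e
  proof -
    obtain M where "0 < M" "(L - e) * M < \<phi> M" using \<phi>_gt[OF e] by blast
    then show ?thesis by (intro exI[of _ M] conjI exI[of _ 0]) (auto simp: \<phi>)
  qed
  have block_k: "\<exists>M>0. \<exists>T\<ge>0. \<forall>t\<ge>T. (L - e) * M \<le> ln (kraichnan_H kt (t + M) t)" if e: "0 < e" for e
  proof -
    obtain M where M: "0 < M" "(L - e) * M < \<phi> M" using \<phi>_gt[OF e] by blast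
    have "exp ((L - e) * M) < kraichnan_H ?\<kappa> M 0" using \<phi>[of 0 M] M by simp
    then obtain \<theta> where \<theta>: "0 < \<theta>" "\<theta> < 1"
      and block: "\<And>k' B' t. bounded_kernel k' B' \<Longrightarrow> 0 \<le> t \<Longrightarrow>
        (\<And>u r. t \<le> u \<Longrightarrow> u \<le> r \<Longrightarrow> r \<le> t + M \<Longrightarrow> \<theta> * ?\<kappa> r u \<le> k' r u) \<Longrightarrow>
        exp ((L - e) * M) \<le> kraichnan_H k' (t + M) t"
      using \<kappa>.kraichnan_H_lower_semicontinuous[OF stat less_imp_le[OF M(1)]] by metis
    \<comment> \<open>An error below \<open>(1 - \<theta>) * C\<close> gives
      \<open>h \<ge> \<theta> * C\<close> on every block beyond \<open>T\<close>. As
      \<open>k1 \<ge> \<theta> * k1\<close>, the whole kernel is then at least \<theta> times the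
      stationary one.\<close>
    have "\<forall>\<^sub>F T in at_top. \<delta> M T < (1 - \<theta>) * C \<and> 0 < T"
      using \<theta> C_pos by (intro eventually_conj order_tendstoD(2)[OF \<delta>_lim[OF M(1)]] eventually_gt_at_top) auto
    then obtain T where T: "\<delta> M T < (1 - \<theta>) * C" "0 < T"
      by (auto dest: eventually_happens)
    have "(L - e) * M \<le> ln (kraichnan_H kt (t + M) t)" if t: "T \<le> t" for t
    proof -
      have "exp ((L - e) * M) \<le> kraichnan_H kt (t + M) t"
      proof (rule block[OF kt.bounded_kernel_axioms])
        fix u r assume ur: "t \<le> u" "u \<le> r" "r \<le> t + M"
        have "\<bar>h r u - C\<bar> \<le> \<delta> M T" using ur t T M by (intro h_close) auto
        then have "\<theta> * C \<le> h r u" using T by (simp add: algebra_simps)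
        moreover have "\<theta> * k1 (r - u) \<le> k1 (r - u)"
          using \<theta> k1_nonneg[of "r - u"] ur by (simp add: mult_left_le_one_le)
        ultimately show "\<theta> * ?\<kappa> r u \<le> kt r u"
          using ur t T by (simp add: kt_def stationary_kernel_def decomp distrib_left)
      qed (use t T in auto)
      then show ?thesis
        by (metis exp_gt_zero ln_exp ln_le_cancel_iff order_less_le_trans)
    qed
    then show ?thesis using M(1) T(2) by (meson less_imp_le)
  qed
  \<comment> \<open>\<open>h \<le> C\<close> is available beyond any positive time, here
    \<open>t\<close> itself, so the kernels compare on all of \<open>[t, t + u]\<close>.\<close>
  have upper_k: "ln (kraichnan_H kt (t + u) t) \<le> L * u" if "0 < t" "0 < u" for t u
  proof -
    have "kraichnan_H kt (t + u) t \<le> kraichnan_H ?\<kappa> (t + u) t"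
    proof (rule kt.kraichnan_H_mono_kernel[OF \<kappa>.bounded_kernel_axioms])
      fix v r assume "t \<le> v" "v \<le> r"
      then show "kt r v \<le> ?\<kappa> r v"
        using h_bound[of t v r] that by (simp add: kt_def stationary_kernel_def decomp)
    qed (use that in auto)
    also have "\<dots> = exp (\<phi> u)" using that by (intro \<phi>) auto
    finally have "ln (kraichnan_H kt (t + u) t) \<le> ln (exp (\<phi> u))"
      using kt.one_le_kraichnan_H[of t "t + u"] that by (intro ln_mono) auto
    then have "ln (kraichnan_H kt (t + u) t) \<le> \<phi> u" by simp
    also have "\<dots> \<le> L * u" using that by (intro \<phi>_le) auto
    finally show ?thesis .
  qed
  have "has_growth_rate (kraichnan_H k) L"
    unfolding kt_H
    by (intro supermultiplicative_has_growth_rate kt.one_le_kraichnan_H kt.kraichnan_H_supermult block_k upper_k)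
  moreover have "has_growth_rate (kraichnan_H ?\<kappa>) L"
    by (intro supermultiplicative_has_growth_rate \<kappa>.one_le_kraichnan_H \<kappa>.kraichnan_H_supermult block_\<kappa>)
      (auto simp: \<phi> \<phi>_le)
  moreover have "lambda_c (\<lambda>u. kraichnan_H ?\<kappa> u 0) = ereal L"
  proof (rule lambda_c_eqI)
    show "kraichnan_H ?\<kappa> u 0 \<le> exp (L * u)" if "0 \<le> u" for u
      using \<phi>[of 0 u] \<phi>_le[OF that] that by simp
    fix e :: real assume "0 < e"
    then have "\<exists>T\<ge>0. \<exists>U>0. \<forall>t\<ge>T. \<forall>u\<ge>U. L - e \<le> ln (kraichnan_H ?\<kappa> (t + u) t) / u"
      by (intro supermultiplicative_growth_lower \<kappa>.one_le_kraichnan_H \<kappa>.kraichnan_H_supermult block_\<kappa>)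
    then obtain T U where TU: "0 \<le> T" "0 < U"
        "\<And>t u. T \<le> t \<Longrightarrow> U \<le> u \<Longrightarrow> L - e \<le> ln (kraichnan_H ?\<kappa> (t + u) t) / u"
      by blast
    have "exp ((L - e) * u) \<le> kraichnan_H ?\<kappa> u 0" if "U \<le> u" for u
    proof -
      \<comment> \<open>Stationarity moves the starting point from \<open>T\<close> back to
        0.\<close>
      have "L - e \<le> \<phi> u / u" using TU(3)[of T u] TU(1,2) that by (simp add: \<phi>)
      then show ?thesis using \<phi>[of 0 u] TU(2) that by (simp add: field_simps)
    qed
    then show "\<exists>U\<ge>0. \<forall>u\<ge>U. exp ((L - e) * u) \<le> kraichnan_H ?\<kappa> u 0"
      using TU(2) by (meson less_imp_le)
  qed
  ultimately show ?thesis by blast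
qed

end
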